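(* Let $A_1,\dots,A_m$ be real symmetric $n\times n$ matrices, let $\mathcal{A}X=(A_1\bullet X,\dots,A_m\bullet X)^\top$ for $X\in\mathcal{S}^n$, and let $b\in\mathbb{R}^m$. The semidefinite feasibility problem $$\mathcal{A}X=b,\quad X\in\mathcal{S}^n_+ \qquad (P)$$ is weakly infeasible if and only if it has a reformulation $$\mathcal{A}'X=b',\quad X\succeq 0,$$ where $\mathcal{A}'X=(A_1'\bullet X,\dots,A_m'\bullet X)^\top$, with the following properties: 1. For some $k\ge 1$ (with $k+1\le m$), the sequence $(A_1',\dots,A_{k+1}')$ is in semidefinite echelon form and $(b_1',\dots,b_k',b_{k+1}')=(0,\dots,0,-1)$. 2. There is a sequence $(X_1,\dots,X_{\ell+1})$ of matrices in $\mathcal{S}^n$ in semidefinite echelon form such that $\ell\ge 1$, $\mathcal{A}'X_i=0$ for $i=1,\dots,\ell$, and $\mathcal{A}'X_{\ell+1}=b'$.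
   Context: $\mathcal{S}^n$ is the space of real symmetric $n\times n$ matrices, $\mathcal{S}^n_+$ the cone of positive semidefinite ones, $X\succeq 0$ means $X\in\mathcal{S}^n_+$, and $A\bullet X=\operatorname{trace}(AX)$. $N=\{1,\dots,n\}$. For a matrix $M$ and $R,S\subseteq N$, $M(R,S)$ is the submatrix with rows in $R$ and columns in $S$, and $M(R)=M(R,R)$. Weak infeasibility: $(P)$ is weakly infeasible if it has no feasible solution, but the affine set $\{X\in\mathcal{S}^n:\mathcal{A}X=b\}$ has zero distance to $\mathcal{S}^n_+$ (the distance from an empty set being $+\infty$). Reformulation: a reformulation of $(P)$ is any problem obtained from it by applying finitely many of the following operations, in any order: (1) exchange $(A_i,b_i)$ and $(A_j,b_j)$ for distinct $i,j$; (2) replace $(A_i,b_i)$ by $\lambda(A_i,b_i)+\mu(A_j,b_j)$, where $i\ne j$, $\lambda,\mu\in\mathbb{R}$, $\lambda\neq 0$; (3) replace all $A_i$ by $T^\top A_iT$, where $T$ is an invertible real $n\times n$ matrix. Semidefinite echelon form: a sequence $(M_1,\dots,M_k)$ of matrices in $\mathcal{S}^n$ is in semidefinite echelon form with structure $\{P_1,\dots,P_k\}$ if the $P_i$ are disjoint (possibly empty) subsets of $N$ and, for each $i=1,\dots,k$: $M_i(P_i)$ is diagonal with positive diagonal entries; $M_i(P_1\cup\dots\cup P_{i-1},N)$, and by symmetry its transpose $M_i(N,P_1\cup\dots\cup P_{i-1})$, is arbitrary; and all remaining entries of $M_i$ are zero. A sequence is in semidefinite echelon form if it is so with some structure. *)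

theory Defs
  imports "HOL-Analysis.Analysis"
begin

text \<open>
  The index set of an \<open>n \<times> n\<close> matrix is the finite type \<open>'n\<close>, which plays the role of
  \<open>{1, \<dots>, n}\<close>. Sequences of matrices and of constraints are lists, hence indexed from 0. The type
  \<open>real^'n^'n\<close> carries the Frobenius norm.
\<close>

definition sym_mats :: "(real^'n^'n) set" where
  "sym_mats = {X. transpose X = X}"

definition psd :: "(real^'n^'n) set" where
  "psd = {X \<in> sym_mats. \<forall>v. 0 \<le> v \<bullet> (X *v v)}"

definition mat_dot :: "real^'n^'n \<Rightarrow> real^'n^'n \<Rightarrow> real" where
  "mat_dot A X = trace (A ** X)"

text \<open>
  A system is the list of the pairs \<open>(A\<^sub>i, b\<^sub>i)\<close>, standing for the constraints \<open>mat_dot A\<^sub>i X = b\<^sub>i\<close>.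
\<close>

type_synonym 'n sdp = "((real^'n^'n) \<times> real) list"

definition lhs :: "'n::finite sdp \<Rightarrow> real^'n^'n \<Rightarrow> real list" where
  "lhs S X = map (\<lambda>A. mat_dot A X) (map fst S)"

definition rhs :: "'n::finite sdp \<Rightarrow> real list" where
  "rhs S = map snd S"

definition affine_set :: "'n::finite sdp \<Rightarrow> (real^'n^'n) set" where
  "affine_set S = {X \<in> sym_mats. lhs S X = rhs S}"

text \<open>
  Nonemptiness is required explicitly because \<^const>\<open>setdist\<close> is 0, not infinite, on the empty set.
\<close>

definition weakly_infeasible :: "'n::finite sdp \<Rightarrow> bool" where
  "weakly_infeasible S \<longleftrightarrow>
     (\<nexists>X. X \<in> psd \<and> lhs S X = rhs S) \<and>
     affine_set S \<noteq> {} \<and> setdist (affine_set S) psd = 0"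

inductive reform_step :: "'n::finite sdp \<Rightarrow> 'n sdp \<Rightarrow> bool" where
  exchange:
    "\<lbrakk>i < length S; j < length S; i \<noteq> j\<rbrakk>
       \<Longrightarrow> reform_step S (S[i := S ! j, j := S ! i])"
| combine:
    "\<lbrakk>i < length S; j < length S; i \<noteq> j; lam \<noteq> 0\<rbrakk>
       \<Longrightarrow> reform_step S (S[i := lam *\<^sub>R (S ! i) + mu *\<^sub>R (S ! j)])"
| congruence:
    "invertible T
       \<Longrightarrow> reform_step S (map (\<lambda>(A, \<beta>). (transpose T ** A ** T, \<beta>)) S)"

definition reformulation :: "'n::finite sdp \<Rightarrow> 'n sdp \<Rightarrow> bool" where
  "reformulation = reform_step\<^sup>*\<^sup>*"

definition sd_echelon_with :: "(real^'n^'n) list \<Rightarrow> 'n set list \<Rightarrow> bool" where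
  "sd_echelon_with Ms Ps \<longleftrightarrow>
     length Ps = length Ms \<and>
     set Ms \<subseteq> sym_mats \<and>
     (\<forall>i<length Ps. \<forall>j<length Ps. i \<noteq> j \<longrightarrow> Ps ! i \<inter> Ps ! j = {}) \<and>
     (\<forall>i<length Ms.
        (\<forall>r\<in>Ps ! i. Ms ! i $ r $ r > 0) \<and>
        (\<forall>r\<in>Ps ! i. \<forall>s\<in>Ps ! i. r \<noteq> s \<longrightarrow> Ms ! i $ r $ s = 0) \<and>
        (\<forall>r s. r \<notin> (\<Union>j<i. Ps ! j) \<longrightarrow> s \<notin> (\<Union>j<i. Ps ! j) \<longrightarrow>
               \<not> (r \<in> Ps ! i \<and> s \<in> Ps ! i) \<longrightarrow> Ms ! i $ r $ s = 0))"

definition sd_echelon :: "(real^'n^'n) list \<Rightarrow> bool" where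
  "sd_echelon Ms \<longleftrightarrow> (\<exists>Ps. sd_echelon_with Ms Ps)"

end

theory Submission
  imports Defs
begin

text \<open>
  Infeasibility yields, by separating the row space from the cone spanned by the rank-one matrices
  of a face and passing to the exposed face, constraint matrices each of which is positive
  semidefinite on the common kernel of the previous ones. Distance zero yields, by compactness,
  solutions \<open>X\<^sub>i\<close> of the homogeneous system with the same property, followed by a solution of the
  system. The kernels form one flag for the constraint matrices and, dually, one flag for the
  \<open>X\<^sub>i\<close>; a basis adapted to both, chosen orthogonal for all the forms on the graded pieces, brings
  both sequences to echelon form by the same congruence. Conversely, Finsler's lemma turns the
  \<open>X\<^sub>i\<close> into nearly positive semidefinite solutions, and the echelon form of the constraints forces
  a positive semidefinite solution to vanish successively on the blocks \<open>P\<^sub>1, \<dots>, P\<^sub>k\<close>, contradicting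
  the right-hand side \<open>-1\<close>.
\<close>

section \<open>Semidefinite forms\<close>

text \<open>A congruence of the constraint matrices by \<open>T\<close> acts on solutions through
  the inverse of \<open>T\<close>, so the two echelon forms must be read in a basis and in its dual.
  The obstacle is the diagonal shape of the blocks: it ties each basis vector to its dual vector,
  each being, on the subspace of its level, a positive multiple of the image of the other under the
  form of that level. This is an eigenvector condition; the eigenvalue is harmless because diagonal
  entries only have to be positive. Separation may return a row with right-hand side 0, and
  normalised solutions may tend to a recession direction. Both degenerate outcomes are kept: each
  becomes a member of its sequence, and the argument restarts on its kernel. The bound on
  \<open>l\<close> is met by a zero matrix with an empty block. The bound on \<open>k\<close> is
  genuine: for \<open>k = 0\<close> a matrix that is nonnegative on \<open>psd\<close> would have to
  take the value -1 on nearly positive semidefinite solutions.\<close>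

lemma psd_form_zero:
  fixes D :: "'a::real_vector \<Rightarrow> 'a \<Rightarrow> real"
  assumes D: "bilinear D" and G: "subspace G"
    and sym: "\<And>x y. x \<in> G \<Longrightarrow> y \<in> G \<Longrightarrow> D x y = D y x"
    and nonneg: "\<And>x. x \<in> G \<Longrightarrow> 0 \<le> D x x"
    and z: "z \<in> G" "D z z = 0" and w: "w \<in> G"
  shows "D z w = 0"
proof (rule ccontr)
  assume ne: "D z w \<noteq> 0"
  \<comment> \<open>Along \<open>w + t z\<close> the form is affine in \<open>t\<close> with slope
    \<open>2 * D z w\<close>; this \<open>t\<close> makes its value -1.\<close>
  define t where "t = - (D w w + 1) / (2 * D z w)"
  have "w + t *\<^sub>R z \<in> G"
    by (simp add: G w z subspace_add subspace_scale)
  from nonneg[OF this] have "0 \<le> D w w + 2 * t * D z w"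
    using z sym[OF w z(1)] 
    by (simp add: bilinear_ladd[OF D] bilinear_radd[OF D] bilinear_lmul[OF D] bilinear_rmul[OF D] algebra_simps)
  moreover have "2 * t * D z w = - (D w w + 1)"
    using ne by (simp add: t_def)
  ultimately show False by simp
qed

lemma bilinear_diff_form:
  fixes P Q :: "'a::real_vector \<Rightarrow> 'a \<Rightarrow> real"
  assumes P: "bilinear P" and Q: "bilinear Q"
  shows "bilinear (\<lambda>x y. c * Q x y - P x y)"
  using assms unfolding bilinear_def linear_iff
  by (auto simp: algebra_simps)

text \<open>Isotropic vectors of an indefinite form need not be closed under addition;
  semidefiniteness puts them in the radical, so cross terms vanish.\<close>

lemma psd_form_kernel_subspace:
  fixes D :: "'a::real_vector \<Rightarrow> 'a \<Rightarrow> real"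
  assumes D: "bilinear D" and G: "subspace G"
    and sym: "\<And>x y. x \<in> G \<Longrightarrow> y \<in> G \<Longrightarrow> D x y = D y x"
    and nonneg: "\<And>x. x \<in> G \<Longrightarrow> 0 \<le> D x x"
  shows "subspace {z \<in> G. D z z = 0}"
proof (rule subspaceI)
  show "0 \<in> {z \<in> G. D z z = 0}"
    by (simp add: G subspace_0 bilinear_lzero[OF D])
next
  fix x y assume xy: "x \<in> {z \<in> G. D z z = 0}" "y \<in> {z \<in> G. D z z = 0}"
  have "D x y = 0" "D y x = 0"
    using xy psd_form_zero[OF D G sym nonneg] by auto
  then show "x + y \<in> {z \<in> G. D z z = 0}"
    using xy by (simp add: G subspace_add bilinear_ladd[OF D] bilinear_radd[OF D])
next
  fix c x assume "x \<in> {z \<in> G. D z z = 0}"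
  then show "c *\<^sub>R x \<in> {z \<in> G. D z z = 0}"
    by (simp add: G subspace_scale bilinear_lmul[OF D] bilinear_rmul[OF D])
qed

lemma subspace_orthogonal_within: "subspace G \<Longrightarrow> subspace {z \<in> G. \<forall>w\<in>Z. z \<bullet> w = 0}"
  for G :: "'a::real_inner set"
  by (auto simp: subspace_def inner_add_left)

text \<open>The Rayleigh quotient is maximised on the orthogonal complement of the kernel of \<open>Q\<close>;
  at a maximiser \<open>z\<close> the form \<open>lam Q - P\<close> is positive semidefinite and vanishes.\<close>

lemma generalised_eigenvector:
  fixes P Q :: "'a::euclidean_space \<Rightarrow> 'a \<Rightarrow> real"
  assumes P: "bilinear P" and Q: "bilinear Q" and G: "subspace G"
    and symP: "\<And>x y. x \<in> G \<Longrightarrow> y \<in> G \<Longrightarrow> P x y = P y x"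
    and symQ: "\<And>x y. x \<in> G \<Longrightarrow> y \<in> G \<Longrightarrow> Q x y = Q y x"
    and nonnegP: "\<And>x. x \<in> G \<Longrightarrow> 0 \<le> P x x"
    and nonnegQ: "\<And>x. x \<in> G \<Longrightarrow> 0 \<le> Q x x"
    and ker: "\<And>x. x \<in> G \<Longrightarrow> Q x x = 0 \<Longrightarrow> P x x = 0"
    and g0: "g0 \<in> G" "P g0 g0 \<noteq> 0"
  obtains z lam where "z \<in> G" "lam > 0" "Q z z > 0" "\<And>w. w \<in> G \<Longrightarrow> P z w = lam * Q z w"
proof -
  define Z where "Z = {z \<in> G. Q z z = 0}"
  define C where "C = {z \<in> G. \<forall>w\<in>Z. z \<bullet> w = 0}"
  have Z: "subspace Z" unfolding Z_def by (rule psd_form_kernel_subspace[OF Q G symQ nonnegQ])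
  have C: "subspace C" unfolding C_def by (rule subspace_orthogonal_within[OF G])
  \<comment> \<open>Both forms ignore the component in the kernel of \<open>Q\<close>: by
    \<open>ker\<close> it is isotropic for \<open>P\<close> too, hence radical for both. On
    \<open>C\<close> the form \<open>Q\<close> is definite and the quotient continuous.\<close>
  have decomp: "\<exists>c\<in>C. P g g = P c c \<and> Q g g = Q c c" if g: "g \<in> G" for g
  proof -
    obtain y c where y: "y \<in> span Z" and c: "\<And>w. w \<in> span Z \<Longrightarrow> orthogonal c w" and gyc: "g = y + c"
      using orthogonal_subspace_decomp_exists by metis
    have yZ: "y \<in> Z" using y Z by (simp add: span_eq_iff[THEN iffD2])
    have cG: "c \<in> G" using gyc g yZ subspace_diff[OF G g, of y] by (simp add: Z_def)
    have "c \<in> C" using c cG by (auto simp: C_def orthogonal_def span_base)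
    moreover have "Q y c = 0" "Q c y = 0" "Q y y = 0"
      using psd_form_zero[OF Q G symQ nonnegQ, of y c] yZ cG symQ[of c y] by (auto simp: Z_def)
    moreover have "P y y = 0" using yZ ker by (auto simp: Z_def)
    moreover then have "P y c = 0" "P c y = 0"
      using psd_form_zero[OF P G symP nonnegP, of y c] yZ cG symP[of c y] by (auto simp: Z_def)
    ultimately show ?thesis
      by (intro bexI[of _ c])
         (auto simp: gyc bilinear_ladd[OF P] bilinear_radd[OF P] bilinear_ladd[OF Q] bilinear_radd[OF Q])
  qed
  have Qpos: "Q c c > 0" if "c \<in> C" "c \<noteq> 0" for c
  proof -
    have "c \<in> G" using that by (simp add: C_def)
    moreover have "Q c c \<noteq> 0"
    proof
      assume "Q c c = 0"
      then have "c \<in> Z" using that by (simp add: Z_def C_def)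
      then have "c \<bullet> c = 0" using that by (simp add: C_def)
      then show False using that by simp
    qed
    ultimately show ?thesis using nonnegQ[of c] by simp
  qed
  define K where "K = C \<inter> sphere 0 1"
  have "compact K" unfolding K_def
    by (intro closed_Int_compact closed_subspace C compact_sphere)
  moreover have "K \<noteq> {}"
  proof -
    obtain c where c: "c \<in> C" "P g0 g0 = P c c" using decomp[OF g0(1)] by blast
    have "c \<noteq> 0" using c g0(2) by (auto simp: bilinear_lzero[OF P])
    then have "c /\<^sub>R norm c \<in> K"
      using c C by (simp add: K_def subspace_scale)
    then show ?thesis by blast
  qed
  moreover have "continuous_on K (\<lambda>z. P z z / Q z z)"
    using Qpos bilinear_continuous_on_compose[OF continuous_on_id continuous_on_id P]
      bilinear_continuous_on_compose[OF continuous_on_id continuous_on_id Q]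
    by (intro continuous_on_divide) (force simp: K_def)+
  ultimately have "\<exists>z\<in>K. \<forall>y\<in>K. P y y / Q y y \<le> P z z / Q z z"
    by (rule continuous_attains_sup)
  then obtain z where z: "z \<in> K" and max: "\<And>y. y \<in> K \<Longrightarrow> P y y / Q y y \<le> P z z / Q z z"
    by blast
  define lam where "lam = P z z / Q z z"
  have zC: "z \<in> C" "z \<noteq> 0" and zG: "z \<in> G" using z by (auto simp: K_def C_def)
  have Qz: "Q z z > 0" using Qpos zC by blast
  have D0: "0 \<le> lam * Q x x - P x x" if x: "x \<in> G" for x
  proof -
    obtain c where c: "c \<in> C" "P x x = P c c" "Q x x = Q c c" using decomp[OF x] by blast
    show ?thesis
    proof (cases "c = 0")
      case True
      then show ?thesis using c by (simp add: bilinear_lzero[OF P] bilinear_lzero[OF Q])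
    next
      case False
      let ?u = "c /\<^sub>R norm c"
      have "?u \<in> K" using c C False by (simp add: K_def subspace_scale)
      from max[OF this] have "P c c / Q c c \<le> lam"
        using False by (simp add: lam_def bilinear_lmul[OF P] bilinear_rmul[OF P] bilinear_lmul[OF Q] bilinear_rmul[OF Q])
      then show ?thesis using Qpos[OF c(1) False] c by (simp add: field_simps)
    qed
  qed
  have "P z w = lam * Q z w" if w: "w \<in> G" for w
  proof -
    have "(\<lambda>x y. lam * Q x y - P x y) z w = 0"
      by (rule psd_form_zero[OF bilinear_diff_form[OF P Q] G _ _ zG _ w])
         (use symP symQ D0 Qz in \<open>auto simp: lam_def\<close>)
    then show ?thesis by simp
  qed
  moreover have "lam > 0"
  proof -
    have "0 < P g0 g0" using g0 nonnegP[of g0] by simp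
    also have "\<dots> \<le> lam * Q g0 g0" using D0[OF g0(1)] by simp
    finally show ?thesis using nonnegQ[OF g0(1)] by (simp add: zero_less_mult_iff)
  qed
  ultimately show ?thesis using that zG Qz by blast
qed

text \<open>Finite-dimensional duality, for vectors that are known only through what they
  annihilate.\<close>

lemma double_orthogonal:
  fixes G :: "'a::euclidean_space set"
  assumes G: "subspace G" and x: "\<And>v. (\<And>g. g \<in> G \<Longrightarrow> g \<bullet> v = 0) \<Longrightarrow> x \<bullet> v = 0"
  shows "x \<in> G"
proof -
  obtain y z where yz: "y \<in> span G" "\<And>w. w \<in> span G \<Longrightarrow> orthogonal z w" "x = y + z"
    using orthogonal_subspace_decomp_exists by metis
  have "x \<bullet> z = 0" using yz by (intro x) (auto simp: orthogonal_def span_base inner_commute)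
  moreover have "y \<bullet> z = 0" using yz by (simp add: orthogonal_def inner_commute)
  ultimately have "z = 0" using yz(3) by (simp add: inner_add_left)
  then show ?thesis using yz G by (metis add.right_neutral span_eq_iff)
qed

text \<open>Fredholm alternative: the representable functionals form a subspace \<open>R\<close>,
  and a vector orthogonal to \<open>R\<close> lies in the radical of the form on \<open>G\<close>,
  which \<open>e\<close> annihilates. That it lies in \<open>G\<close> at all holds because
  \<open>R\<close> contains the orthogonal complement of \<open>G\<close>.\<close>

lemma riesz_semidefinite:
  fixes f :: "'a::euclidean_space \<Rightarrow> 'a"
  assumes f: "linear f" and G: "subspace G"
    and sym: "\<And>x y. x \<in> G \<Longrightarrow> y \<in> G \<Longrightarrow> x \<bullet> f y = f x \<bullet> y"
    and e: "\<And>h. h \<in> G \<Longrightarrow> (\<And>k. k \<in> G \<Longrightarrow> f h \<bullet> k = 0) \<Longrightarrow> h \<bullet> e = 0"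
  obtains g where "g \<in> G" "\<And>h. h \<in> G \<Longrightarrow> h \<bullet> e = h \<bullet> f g"
proof -
  define R where "R = {y. \<exists>g\<in>G. \<forall>h\<in>G. h \<bullet> y = h \<bullet> f g}"
  have R: "subspace R"
  proof (rule subspaceI)
    show "0 \<in> R" using G f by (auto simp: R_def linear_0 subspace_0 intro!: bexI[of _ 0])
  next
    fix x y assume "x \<in> R" "y \<in> R"
    then obtain a b where "a \<in> G" "b \<in> G" "\<forall>h\<in>G. h \<bullet> x = h \<bullet> f a" "\<forall>h\<in>G. h \<bullet> y = h \<bullet> f b"
      by (auto simp: R_def)
    then show "x + y \<in> R" using G f
      by (auto simp: R_def linear_add subspace_add inner_add_right intro!: bexI[of _ "a + b"])
  next
    fix c x assume "x \<in> R"
    then obtain a where "a \<in> G" "\<forall>h\<in>G. h \<bullet> x = h \<bullet> f a" by (auto simp: R_def)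
    then show "c *\<^sub>R x \<in> R" using G f
      by (auto simp: R_def linear_cmul subspace_scale intro!: bexI[of _ "c *\<^sub>R a"])
  qed
  have "e \<in> R"
  proof (rule double_orthogonal[OF R])
    fix v assume v: "\<And>g. g \<in> R \<Longrightarrow> g \<bullet> v = 0"
    have vG: "v \<in> G"
    proof (rule double_orthogonal[OF G])
      fix u assume "\<And>g. g \<in> G \<Longrightarrow> g \<bullet> u = 0"
      then have "u \<in> R" using G f by (auto simp: R_def linear_0 subspace_0 intro!: bexI[of _ 0])
      then show "v \<bullet> u = 0" using v by (simp add: inner_commute)
    qed
    have "f v \<bullet> k = 0" if k: "k \<in> G" for k
    proof -
      have "f k \<in> R" using k by (auto simp: R_def)
      from v[OF this] show ?thesis using sym[OF vG k] by (simp add: inner_commute)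
    qed
    from e[OF vG this] show "e \<bullet> v = 0" by (simp add: inner_commute)
  qed
  then show ?thesis using that by (auto simp: R_def)
qed

section \<open>Bases adapted to two flags\<close>

text \<open>For biorthogonal families this is the oblique projection onto the common kernel of the
  \<open>f r\<close> along the span of the \<open>e r\<close>. Exchanging \<open>e\<close> and
  \<open>f\<close> gives its adjoint.\<close>

definition proj_along :: "'i set \<Rightarrow> ('i \<Rightarrow> 'a::real_inner) \<Rightarrow> ('i \<Rightarrow> 'a) \<Rightarrow> 'a \<Rightarrow> 'a" where
  "proj_along R e f w = w - (\<Sum>r\<in>R. (f r \<bullet> w) *\<^sub>R e r)"

lemma linear_proj_along: "linear (proj_along R e f)"
  unfolding proj_along_def linear_iff
  by (simp add: inner_add_right scaleR_add_left sum.distrib scaleR_sum_right algebra_simps)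

lemma proj_along_adjoint: "u \<bullet> proj_along R e f w = proj_along R f e u \<bullet> w"
  by (simp add: proj_along_def inner_diff_left inner_diff_right inner_sum_left inner_sum_right
      inner_commute mult.commute)

lemma proj_along_id: "(\<And>r. r \<in> R \<Longrightarrow> f r \<bullet> w = 0) \<Longrightarrow> proj_along R e f w = w"
  by (simp add: proj_along_def)

lemma inner_proj_along:
  assumes "finite R" "\<And>r s. r \<in> R \<Longrightarrow> s \<in> R \<Longrightarrow> f r \<bullet> e s = (if r = s then 1 else 0)" "s \<in> R"
  shows "f s \<bullet> proj_along R e f w = 0"
proof -
  have "(\<Sum>r\<in>R. (f r \<bullet> w) * (f s \<bullet> e r)) = (\<Sum>r\<in>R. if r = s then f s \<bullet> w else 0)"
    by (rule sum.cong) (use assms in auto)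
  then show ?thesis using assms
    by (simp add: proj_along_def inner_diff_right inner_sum_right)
qed

text \<open>Facial reduction as a flag: \<open>A i\<close> induces a positive definite form on the
  quotient of \<open>L i\<close> by \<open>L (Suc i)\<close>. The end \<open>{0}\<close> guarantees
  a level for every nonzero vector.\<close>

definition psd_flag :: "(nat \<Rightarrow> real^'n^'n) \<Rightarrow> (nat \<Rightarrow> (real^'n) set) \<Rightarrow> nat \<Rightarrow> bool" where
  "psd_flag A L K \<longleftrightarrow> L 0 = UNIV \<and> L K = {0} \<and>
     (\<forall>i<K. transpose (A i) = A i \<and> (\<forall>v\<in>L i. 0 \<le> v \<bullet> (A i *v v)) \<and>
        L (Suc i) = {v \<in> L i. v \<bullet> (A i *v v) = 0})"

lemma bilinear_matrix: "bilinear (\<lambda>x y. x \<bullet> (M *v y))" for M :: "real^'n^'n"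
  unfolding bilinear_def linear_iff
  by (simp add: inner_add_left inner_add_right matrix_vector_right_distrib matrix_vector_mult_scaleR)

lemma inner_matrix_sym: "transpose M = M \<Longrightarrow> x \<bullet> (M *v y) = y \<bullet> (M *v x)" for M :: "real^'n^'n"
  by (metis dot_lmul_matrix inner_commute transpose_matrix_vector)

lemma psd_flag_subspace: "psd_flag A L K \<Longrightarrow> i \<le> K \<Longrightarrow> subspace (L i)"
proof (induction i)
  case (Suc i)
  then have "subspace {v \<in> L i. v \<bullet> (A i *v v) = 0}"
    by (intro psd_form_kernel_subspace[OF bilinear_matrix])
       (auto simp: psd_flag_def Suc_le_eq inner_matrix_sym)
  then show ?case using Suc by (auto simp: psd_flag_def Suc_le_eq)
qed (simp add: psd_flag_def)

lemma psd_flag_antimono: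
  assumes "psd_flag A L K" "i \<le> j" "j \<le> K" shows "L j \<subseteq> L i"
  using assms(2,3)
proof (induction j rule: dec_induct)
  case (step j)
  then show ?case using assms(1) by (auto simp: psd_flag_def Suc_le_eq)
qed simp

lemma psd_flag_kernel:
  assumes fl: "psd_flag A L K" and i: "i < K" and v: "v \<in> L (Suc i)" and w: "w \<in> L i"
  shows "v \<bullet> (A i *v w) = 0" "w \<bullet> (A i *v v) = 0"
proof -
  show "v \<bullet> (A i *v w) = 0"
    by (rule psd_form_zero[OF bilinear_matrix psd_flag_subspace[OF fl, of i]])
       (use assms in \<open>auto simp: psd_flag_def inner_matrix_sym\<close>)
  then show "w \<bullet> (A i *v v) = 0"
    using fl i inner_matrix_sym[of "A i" w v] by (simp add: psd_flag_def)
qed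

text \<open>The relation turns biorthogonality into orthogonality for \<open>A p\<close>. It is
  imposed on \<open>L p\<close> only, since entries of \<open>A p\<close> against basis vectors of
  lower level are the arbitrary ones of echelon form.\<close>

definition flag_vector ::
    "(nat \<Rightarrow> real^'n^'n) \<Rightarrow> (nat \<Rightarrow> (real^'n) set) \<Rightarrow> nat \<Rightarrow> real^'n \<Rightarrow> real^'n \<Rightarrow> bool" where
  "flag_vector A L p e f \<longleftrightarrow> e \<in> L p \<and> (\<exists>c>0. \<forall>w\<in>L p. f \<bullet> w = c * (e \<bullet> (A p *v w)))"

lemma flag_vector_zero:
  assumes "psd_flag A L K" "flag_vector A L p e f" "p < i" "i \<le> K" "w \<in> L i"
  shows "f \<bullet> w = 0"
proof -
  have "w \<in> L (Suc p)" "w \<in> L p"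
    using psd_flag_antimono[of A L K "Suc p" i] psd_flag_antimono[of A L K p i] assms by auto
  then show ?thesis using assms psd_flag_kernel(2)[of A L K p w e]
    by (auto simp: flag_vector_def)
qed

text \<open>Every correction term lies in \<open>L i\<close>: its coefficient vanishes when
  \<open>e r\<close> has level below \<open>i\<close>, and otherwise \<open>e r\<close> itself is in
  \<open>L i\<close>.\<close>

lemma proj_along_flag:
  assumes fl: "psd_flag A L K" and fam: "\<And>r. r \<in> R \<Longrightarrow> p r < K \<and> flag_vector A L (p r) (e r) (f r)"
    and i: "i \<le> K" and w: "w \<in> L i"
  shows "proj_along R e f w \<in> L i"
proof -
  have "(f r \<bullet> w) *\<^sub>R e r \<in> L i" if r: "r \<in> R" for r
  proof (cases "p r < i")
    case True
    then have "f r \<bullet> w = 0" using flag_vector_zero[OF fl _ _ i w] fam r by blast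
    then show ?thesis using psd_flag_subspace[OF fl i] by (simp add: subspace_0)
  next
    case False
    then have "e r \<in> L i"
      using fam[OF r] psd_flag_antimono[OF fl, of i "p r"] by (auto simp: flag_vector_def)
    then show ?thesis using psd_flag_subspace[OF fl i] by (simp add: subspace_scale)
  qed
  then show ?thesis unfolding proj_along_def
    by (intro subspace_diff subspace_sum psd_flag_subspace[OF fl i] w)
qed

text \<open>Each correction term is invisible to \<open>x\<close>: lower levels have coefficient
  zero, higher levels lie in the radical of \<open>A i\<close> on \<open>L i\<close>, and on level
  \<open>i\<close> the hypothesis on \<open>f r\<close> and \<open>x\<close> says that
  \<open>e r\<close> and \<open>x\<close> are orthogonal for \<open>A i\<close>.\<close>

lemma form_proj_along:
  assumes fl: "psd_flag A L K" and fam: "\<And>r. r \<in> R \<Longrightarrow> p r < K \<and> flag_vector A L (p r) (e r) (f r)"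
    and i: "i < K" and w: "w \<in> L i" and x: "x \<in> L i" "\<And>r. r \<in> R \<Longrightarrow> f r \<bullet> x = 0"
  shows "x \<bullet> (A i *v proj_along R e f w) = x \<bullet> (A i *v w)"
proof -
  have "(f r \<bullet> w) * (x \<bullet> (A i *v e r)) = 0" if r: "r \<in> R" for r
  proof (cases "p r" i rule: linorder_cases)
    case less
    then show ?thesis using flag_vector_zero[OF fl, of "p r" "e r" "f r" i w] fam[OF r] i w by simp
  next
    case greater
    then have "e r \<in> L (Suc i)"
      using fam[OF r] psd_flag_antimono[OF fl, of "Suc i" "p r"] by (auto simp: flag_vector_def)
    then show ?thesis using psd_flag_kernel(2)[OF fl i _ x(1)] by simp
  next
    case equal
    then obtain c where "c > 0" "f r \<bullet> x = c * (e r \<bullet> (A i *v x))"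
      using fam[OF r] x(1) by (auto simp: flag_vector_def)
    then have "e r \<bullet> (A i *v x) = 0" using x(2)[OF r] by simp
    then show ?thesis using inner_matrix_sym[of "A i" x "e r"] fl i by (simp add: psd_flag_def)
  qed
  then have "(\<Sum>r\<in>R. (f r \<bullet> w) * (x \<bullet> (A i *v e r))) = 0" by (rule sum.neutral[OF ballI])
  then show ?thesis
    by (simp add: proj_along_def matrix_vector_mult_diff_distrib inner_diff_right
        inner_sum_right matrix_vector_mult_scaleR
        linear_sum[OF matrix_vector_mul_linear])
qed

definition biorthogonal :: "'i set \<Rightarrow> ('i \<Rightarrow> 'a::real_inner) \<Rightarrow> ('i \<Rightarrow> 'a) \<Rightarrow> bool" where
  "biorthogonal R e f \<longleftrightarrow> (\<forall>r\<in>R. \<forall>s\<in>R. f r \<bullet> e s = (if r = s then 1 else 0))"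

lemma nat_switch:
  assumes "P (0::nat)" "\<not> P K" obtains p where "p < K" "P p" "\<not> P (Suc p)"
  using assms
proof (induction K)
  case (Suc K)
  then show ?case by (cases "P K") (auto simp: less_Suc_eq)
qed simp

text \<open>The new vector is a generalised eigenvector: at the first step \<open>p\<close> of the flag \<open>L\<close> and the
  first step \<open>q\<close> of the flag \<open>M\<close> that meet the complement of the given family nontrivially, \<open>A p\<close>
  and the inverse of \<open>X q\<close> are two forms on the same space, which are diagonalised simultaneously.\<close>

lemma two_flags_extend:
  fixes e f :: "'i \<Rightarrow> real^'n"
  assumes flA: "psd_flag A L K" and flX: "psd_flag X M J"
    and R: "finite R" "card R < CARD('n)" and bi: "biorthogonal R e f"
    and famA: "\<And>r. r \<in> R \<Longrightarrow> p r < K \<and> flag_vector A L (p r) (e r) (f r)"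
    and famX: "\<And>r. r \<in> R \<Longrightarrow> q r < J \<and> flag_vector X M (q r) (f r) (e r)"
  obtains e0 f0 p0 q0 where "p0 < K" "q0 < J" "flag_vector A L p0 e0 f0" "flag_vector X M q0 f0 e0"
    "f0 \<bullet> e0 = 1" "\<And>r. r \<in> R \<Longrightarrow> f r \<bullet> e0 = 0" "\<And>r. r \<in> R \<Longrightarrow> f0 \<bullet> e r = 0"
proof -
  define U where "U = {v. \<forall>r\<in>R. f r \<bullet> v = 0}"
  define U' where "U' = {v. \<forall>r\<in>R. e r \<bullet> v = 0}"
  define \<pi> where "\<pi> = proj_along R e f"
  define \<pi>' where "\<pi>' = proj_along R f e"
  have subU: "subspace U" and subU': "subspace U'"
    by (auto simp: U_def U'_def subspace_def inner_add_right)
  have adj: "u \<bullet> \<pi> w = \<pi>' u \<bullet> w" "u \<bullet> \<pi>' w = \<pi> u \<bullet> w" for u w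
    by (simp_all add: \<pi>_def \<pi>'_def proj_along_adjoint)
  have \<pi>_U: "\<pi> w \<in> U" and \<pi>'_U': "\<pi>' w \<in> U'" for w
    using bi R by (auto simp: U_def U'_def \<pi>_def \<pi>'_def biorthogonal_def inner_commute
        intro!: inner_proj_along)
  have \<pi>_id: "w \<in> U \<Longrightarrow> \<pi> w = w" and \<pi>'_id: "w \<in> U' \<Longrightarrow> \<pi>' w = w" for w
    by (auto simp: U_def U'_def \<pi>_def \<pi>'_def intro!: proj_along_id)
  have lin: "linear \<pi>" "linear \<pi>'" by (simp_all add: \<pi>_def \<pi>'_def linear_proj_along)
  \<comment> \<open>The flag \<open>M\<close> lives on the dual side. Its annihilators turn it into
    an increasing filtration of \<open>U\<close>, from \<open>W 0 = {0}\<close> to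
    \<open>W J = U\<close>.\<close>
  define W where "W j = {v \<in> U. \<forall>g\<in>M j. g \<bullet> v = 0}" for j
  have "\<not> U \<subseteq> {0}"
  proof -
    have "dim (f ` R) < DIM(real^'n)"
      using R dim_le_card'[of "f ` R"] card_image_le[of R f] by simp
    then obtain x where "x \<noteq> 0" "\<And>y. y \<in> span (f ` R) \<Longrightarrow> orthogonal x y"
      using orthogonal_to_subspace_exists[of "f ` R"] by metis
    then have "x \<in> U" "x \<noteq> 0" by (simp_all add: U_def orthogonal_def span_base inner_commute[of _ x])
    then show ?thesis by blast
  qed
  then obtain p0 where p0: "p0 < K" "U \<subseteq> L p0" "\<not> U \<subseteq> L (Suc p0)"
    using nat_switch[of "\<lambda>i. U \<subseteq> L i" K] flA by (auto simp: psd_flag_def)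
  have subL: "subspace (L (Suc p0))" using psd_flag_subspace[OF flA] p0 by simp
  have "W 0 \<subseteq> L (Suc p0)"
  proof
    fix v assume "v \<in> W 0"
    then have "v \<bullet> v = 0" using flX by (auto simp: W_def psd_flag_def)
    then show "v \<in> L (Suc p0)" using subL by (simp add: subspace_0)
  qed
  moreover have "W J = U" using flX by (auto simp: W_def psd_flag_def)
  ultimately obtain q0 where q0: "q0 < J" "W q0 \<subseteq> L (Suc p0)" "\<not> W (Suc q0) \<subseteq> L (Suc p0)"
    using nat_switch[of "\<lambda>j. W j \<subseteq> L (Suc p0)" J] p0 by auto
  define AA where "AA = A p0"
  define XX where "XX = X q0"
  have symA: "x \<bullet> (AA *v y) = y \<bullet> (AA *v x)" for x y
    unfolding AA_def by (rule inner_matrix_sym) (use flA p0 in \<open>auto simp: psd_flag_def\<close>)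
  have symX: "x \<bullet> (XX *v y) = y \<bullet> (XX *v x)" for x y
    unfolding XX_def by (rule inner_matrix_sym) (use flX q0 in \<open>auto simp: psd_flag_def\<close>)
  have kerA: "x \<bullet> (AA *v y) = 0" if "x \<in> L p0" "y \<in> L (Suc p0)" for x y
    using psd_flag_kernel(2)[OF flA p0(1)] that by (simp add: AA_def)
  have kerX: "x \<bullet> (XX *v y) = 0" if "x \<in> M q0" "y \<in> M (Suc q0)" for x y
    using psd_flag_kernel(2)[OF flX q0(1)] that by (simp add: XX_def)
  have \<pi>'_M: "\<pi>' h \<in> M q0" if "h \<in> M q0" for h
    unfolding \<pi>'_def by (rule proj_along_flag[OF flX famX _ that]) (use q0 in simp_all)
  have subM: "subspace (M q0)" using psd_flag_subspace[OF flX] q0 by simp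
  define G where "G = M q0 \<inter> U'"
  have subG: "subspace G" unfolding G_def by (intro subspace_inter subM subU')
  have \<pi>'_G: "\<pi>' h \<in> G" if "h \<in> M q0" for h using \<pi>'_M \<pi>'_U' that by (simp add: G_def)
  \<comment> \<open>The duality behind the rest of the proof: what \<open>G\<close> annihilates
    projects into \<open>W q0\<close>, hence into the radical of \<open>AA\<close> on
    \<open>L p0\<close>.\<close>
  have in_W: "\<pi> v \<in> W q0" if "\<And>h. h \<in> G \<Longrightarrow> h \<bullet> v = 0" for v
    using that \<pi>_U \<pi>'_G by (simp add: W_def adj)
  \<comment> \<open>\<open>XX\<close> may be singular, so in place of its inverse \<open>AA\<close>
    is pulled back to \<open>G\<close> along \<open>XX\<close> followed by the projection, and
    compared there with \<open>XX\<close> itself.\<close>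
  define P where "P x y = \<pi> (XX *v x) \<bullet> (AA *v \<pi> (XX *v y))" for x y
  define Q where "Q x y = x \<bullet> (XX *v y)" for x y
  have bP: "bilinear P" unfolding bilinear_def linear_iff P_def
    by (simp add: inner_add_left inner_add_right matrix_vector_right_distrib matrix_vector_mult_scaleR
        linear_add[OF lin(1)] linear_cmul[OF lin(1)])
  have bQ: "bilinear Q" unfolding Q_def[abs_def] by (rule bilinear_matrix)
  have UL: "v \<in> U \<Longrightarrow> v \<in> L p0" for v using p0 by blast
  have nonnegA: "0 \<le> v \<bullet> (AA *v v)" if "v \<in> U" for v
    using UL[OF that] flA p0 by (auto simp: psd_flag_def AA_def)
  have L_Suc: "v \<in> L (Suc p0) \<longleftrightarrow> v \<in> L p0 \<and> v \<bullet> (AA *v v) = 0" for v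
    using flA p0 by (auto simp: psd_flag_def AA_def)
  have M_Suc: "v \<in> M (Suc q0) \<longleftrightarrow> v \<in> M q0 \<and> v \<bullet> (XX *v v) = 0" for v
    using flX q0 by (auto simp: psd_flag_def XX_def)
  obtain w where w: "w \<in> W (Suc q0)" "w \<notin> L (Suc p0)" using q0 by blast
  then have wU: "w \<in> U" by (simp add: W_def)
  \<comment> \<open>A witness that \<open>P\<close> is not zero. The radical of \<open>XX\<close> on
    \<open>G\<close> lies in \<open>M (Suc q0)\<close>, which \<open>w\<close> annihilates, so
    \<open>XX *v g0\<close> represents \<open>w\<close> on \<open>G\<close>. After projection the
    two agree modulo \<open>L (Suc p0)\<close>, and \<open>w\<close> is outside it.\<close>
  obtain g0 where g0: "g0 \<in> G" "\<And>h. h \<in> G \<Longrightarrow> h \<bullet> w = h \<bullet> (XX *v g0)"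
  proof (rule riesz_semidefinite[OF matrix_vector_mul_linear subG, of XX w])
    show "x \<bullet> (XX *v y) = (XX *v x) \<bullet> y" for x y using symX[of x y] by (simp add: inner_commute)
  next
    fix h assume h: "h \<in> G" "\<And>k. k \<in> G \<Longrightarrow> (XX *v h) \<bullet> k = 0"
    then have "h \<in> M (Suc q0)" by (simp add: M_Suc G_def inner_commute)
    then show "h \<bullet> w = 0" using w by (simp add: W_def)
  qed blast
  have "\<pi> (w - XX *v g0) \<in> L (Suc p0)" using q0(2) in_W[of "w - XX *v g0"] g0 by (auto simp: inner_diff_right)
  then have "w - \<pi> (XX *v g0) \<in> L (Suc p0)" by (simp add: linear_diff[OF lin(1)] \<pi>_id[OF wU])
  then have "\<pi> (XX *v g0) \<notin> L (Suc p0)" using w subspace_add[OF subL] by fastforce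
  then have Pg0: "P g0 g0 \<noteq> 0" using UL[OF \<pi>_U] by (simp add: L_Suc P_def)
  obtain g lam where g: "g \<in> G" "lam > 0" "Q g g > 0" "\<And>h. h \<in> G \<Longrightarrow> P g h = lam * Q g h"
  proof (rule generalised_eigenvector[OF bP bQ subG _ _ _ _ _ g0(1) Pg0])
    show "P x y = P y x" for x y using symA by (simp add: P_def)
    show "Q x y = Q y x" for x y using symX by (simp add: Q_def)
    show "0 \<le> P x x" for x using nonnegA \<pi>_U by (simp add: P_def)
    show "0 \<le> Q x x" if "x \<in> G" for x using flX q0 that by (auto simp: Q_def XX_def psd_flag_def G_def)
    show "P x x = 0" if x: "x \<in> G" "Q x x = 0" for x
    proof -
      have "x \<in> M (Suc q0)" using x by (simp add: M_Suc G_def Q_def)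
      then have "\<pi> (XX *v x) \<in> L (Suc p0)" using q0(2) in_W[of "XX *v x"] kerX by (auto simp: G_def)
      then show ?thesis by (simp add: P_def L_Suc)
    qed
  qed blast
  \<comment> \<open>\<open>g\<close> is carried to the primal side by \<open>XX\<close>, then back
    to the dual side by \<open>AA\<close>. By the eigenvector equation this round trip, tested with
    \<open>XX\<close>, is multiplication by \<open>lam\<close>; \<open>rel2\<close> states
    this.\<close>
  define e1 where "e1 = \<pi> (XX *v g)"
  define f1 where "f1 = \<pi>' (AA *v e1)"
  have e1: "e1 \<in> U" "e1 \<in> L p0" using \<pi>_U UL by (auto simp: e1_def)
  have f1U': "f1 \<in> U'" using \<pi>'_U' by (simp add: f1_def)
  have f1M: "f1 \<in> M q0"
  proof (rule double_orthogonal[OF subM])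
    fix v assume "\<And>h. h \<in> M q0 \<Longrightarrow> h \<bullet> v = 0"
    then have "\<pi> v \<in> L (Suc p0)" using q0(2) in_W[of v] by (auto simp: G_def)
    then have "e1 \<bullet> (AA *v \<pi> v) = 0" using kerA e1 by blast
    then show "f1 \<bullet> v = 0" using symA[of e1 "\<pi> v"] adj(1)[of "AA *v e1" v]
      by (simp add: f1_def inner_commute)
  qed
  have rel1: "f1 \<bullet> v = e1 \<bullet> (AA *v v)" if v: "v \<in> L p0" for v
  proof -
    have "f1 \<bullet> v = e1 \<bullet> (AA *v \<pi> v)"
      using symA[of e1 "\<pi> v"] adj(1)[of "AA *v e1" v] by (simp add: f1_def inner_commute)
    also have "\<dots> = e1 \<bullet> (AA *v v)"
      unfolding AA_def \<pi>_def
      by (rule form_proj_along[OF flA famA p0(1) v e1(2)]) (use e1 in \<open>auto simp: U_def\<close>)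
    finally show ?thesis .
  qed
  have rel2: "lam * (e1 \<bullet> h) = f1 \<bullet> (XX *v h)" if h: "h \<in> M q0" for h
  proof -
    have "e1 \<bullet> h = Q g (\<pi>' h)"
      using adj(1)[of h e1] \<pi>_id[OF e1(1)] adj(1)[of "\<pi>' h" "XX *v g"] \<pi>'_id[OF \<pi>'_U', of h] symX[of g "\<pi>' h"]
      by (simp add: e1_def Q_def inner_commute)
    then have "lam * (e1 \<bullet> h) = P g (\<pi>' h)" using g(4)[OF \<pi>'_G[OF h]] by simp
    also have "\<dots> = f1 \<bullet> (XX *v \<pi>' h)"
      using rel1[OF UL[OF \<pi>_U], of "XX *v \<pi>' h"] adj(1)[of f1 "XX *v \<pi>' h"] \<pi>'_id[OF f1U']
      by (simp add: P_def e1_def)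
    also have "\<dots> = f1 \<bullet> (XX *v h)"
      unfolding XX_def \<pi>'_def
      by (rule form_proj_along[OF flX famX q0(1) h f1M]) (use f1U' in \<open>auto simp: U'_def\<close>)
    finally show ?thesis .
  qed
  \<comment> \<open>Dividing by \<open>d = P g g = lam * Q g g\<close> normalises the pairing; the
    free positive factors in \<open>flag_vector\<close> absorb both \<open>d\<close> and
    \<open>lam\<close>.\<close>
  define d where "d = f1 \<bullet> e1"
  have "d = P g g" using rel1[OF e1(2)] by (simp add: P_def d_def e1_def)
  then have d: "d > 0" using g by simp
  show ?thesis
  proof (rule that[of p0 q0 e1 "f1 /\<^sub>R d"])
    show "flag_vector A L p0 e1 (f1 /\<^sub>R d)" unfolding flag_vector_def
      using e1 rel1 d by (auto simp: AA_def intro!: exI[of _ "1 / d"] simp: divide_inverse)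
    show "flag_vector X M q0 (f1 /\<^sub>R d) e1" unfolding flag_vector_def
    proof (intro conjI exI[of _ "d / lam"] ballI)
      show "f1 /\<^sub>R d \<in> M q0" using f1M subM by (simp add: subspace_scale)
      show "0 < d / lam" using d g by simp
      show "e1 \<bullet> h = d / lam * ((f1 /\<^sub>R d) \<bullet> (X q0 *v h))" if "h \<in> M q0" for h
        using rel2[OF that] d g by (simp add: XX_def field_simps)
    qed
    show "(f1 /\<^sub>R d) \<bullet> e1 = 1" using d by (simp add: d_def)
    show "f r \<bullet> e1 = 0" if "r \<in> R" for r using e1 that by (simp add: U_def)
    show "(f1 /\<^sub>R d) \<bullet> e r = 0" if "r \<in> R" for r
      using f1U' that by (simp add: U'_def inner_commute)
  qed (use p0 q0 in auto)
qed

lemma two_flags_basis: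
  fixes A X :: "nat \<Rightarrow> real^'n^'n"
  assumes flA: "psd_flag A L K" and flX: "psd_flag X M J"
  obtains e f :: "'n \<Rightarrow> real^'n" and p q where "biorthogonal UNIV e f"
    "\<forall>r. p r < K \<and> flag_vector A L (p r) (e r) (f r)"
    "\<forall>r. q r < J \<and> flag_vector X M (q r) (f r) (e r)"
proof -
  have "\<exists>e f p q. biorthogonal R e f \<and> (\<forall>r\<in>R. p r < K \<and> flag_vector A L (p r) (e r) (f r))
      \<and> (\<forall>r\<in>R. q r < J \<and> flag_vector X M (q r) (f r) (e r))" for R :: "'n set"
  using finite[of R]
  proof (induction R rule: finite_induct)
    case empty
    show ?case by (simp add: biorthogonal_def)
  next
    case (insert x R)
    from insert(3) obtain e f :: "'n \<Rightarrow> real^'n" and p q where IH: "biorthogonal R e f"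
      "\<And>r. r \<in> R \<Longrightarrow> p r < K \<and> flag_vector A L (p r) (e r) (f r)"
      "\<And>r. r \<in> R \<Longrightarrow> q r < J \<and> flag_vector X M (q r) (f r) (e r)" by blast
    have "R \<subset> UNIV" using insert by blast
    then have card: "card R < CARD('n)" by (intro psubset_card_mono) auto
    show ?case
    proof (rule two_flags_extend[OF flA flX insert(1) _ IH])
      fix e0 f0 p0 q0
      assume new: "p0 < K" "q0 < J" "flag_vector A L p0 e0 f0" "flag_vector X M q0 f0 e0"
        "f0 \<bullet> e0 = 1" "\<And>r. r \<in> R \<Longrightarrow> f r \<bullet> e0 = 0" "\<And>r. r \<in> R \<Longrightarrow> f0 \<bullet> e r = 0"
      show ?thesis
      by (rule exI[of _ "e(x := e0)"], rule exI[of _ "f(x := f0)"],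
          rule exI[of _ "p(x := p0)"], rule exI[of _ "q(x := q0)"])
         (use insert(2) IH new in \<open>auto simp: biorthogonal_def\<close>)
    qed (use card in auto)
  qed
  from this[of UNIV] show ?thesis using that by auto
qed

section \<open>Echelon form in a common basis\<close>

text \<open>The basis-free content of echelon form: echelon form implies it with
  \<open>L = UNIV\<close>, and for symmetric matrices a congruence recovers echelon form from
  it.\<close>

definition face_seq :: "(real^'n) set \<Rightarrow> (real^'n^'n) list \<Rightarrow> bool" where
  "face_seq L Ms \<longleftrightarrow> (\<forall>i<length Ms. \<forall>v\<in>L. (\<forall>j<i. v \<bullet> (Ms ! j *v v) = 0) \<longrightarrow> 0 \<le> v \<bullet> (Ms ! i *v v))"

lemma face_seq_Nil: "face_seq L []"
  by (simp add: face_seq_def)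

lemma face_seq_Cons: "face_seq L (M # Ms) \<longleftrightarrow>
    (\<forall>v\<in>L. 0 \<le> v \<bullet> (M *v v)) \<and> face_seq {v \<in> L. v \<bullet> (M *v v) = 0} Ms"
  unfolding face_seq_def by (auto simp: All_less_Suc2)

text \<open>Appending the identity matrix makes the flag end in \<open>{0}\<close>.\<close>

lemma psd_flag_face_seq:
  fixes Ms :: "(real^'n^'n) list"
  assumes "face_seq UNIV Ms" "set Ms \<subseteq> sym_mats"
  shows "psd_flag (\<lambda>i. (Ms @ [mat 1]) ! i) (\<lambda>i. {v. \<forall>j<i. v \<bullet> ((Ms @ [mat 1]) ! j *v v) = 0})
    (length Ms + 1)"
  using assms unfolding psd_flag_def face_seq_def sym_mats_def
  by (auto simp: nth_append less_Suc_eq All_less_Suc subset_iff)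

lemma row_congruence_nth:
  "((\<chi> r. e r) ** A ** transpose (\<chi> r. e r)) $ r $ s = e r \<bullet> (A *v e s)" for A :: "real^'n^'n"
  unfolding dot_lmul_matrix[symmetric]
  by (simp add: matrix_matrix_mult_def transpose_def vector_matrix_mult_def inner_vec_def mult.commute)

lemma congruence_sym: "A \<in> sym_mats \<Longrightarrow> B ** A ** transpose B \<in> sym_mats"
  by (simp add: sym_mats_def matrix_transpose_mul matrix_mul_assoc)

text \<open>If the level of \<open>s\<close> is at least that of \<open>r\<close>, then the entry
  \<open>(r, s)\<close> of the matrix at the level of \<open>r\<close> is a positive multiple of the
  pairing of \<open>f r\<close> with \<open>e s\<close>, hence zero unless \<open>r = s\<close>.
  Indices of lower level belong to earlier blocks.\<close>

lemma sd_echelon_flag_basis: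
  assumes fl: "psd_flag A L K" and bi: "biorthogonal UNIV e f"
    and fam: "\<forall>r. p r < K \<and> flag_vector A L (p r) (e r) (f r)"
    and Ms: "length Ms \<le> K" "set Ms \<subseteq> sym_mats" "\<And>i. i < length Ms \<Longrightarrow> Ms ! i = A i"
  shows "sd_echelon (map (\<lambda>M. (\<chi> r. e r) ** M ** transpose (\<chi> r. e r)) Ms)"
proof -
  \<comment> \<open>Indices whose level lies beyond the sequence, such as that of the appended
    identity, belong to no block.\<close>
  define Ps where "Ps = map (\<lambda>i. {r. p r = i}) [0..<length Ms]"
  have inL: "e r \<in> L i" if "i \<le> p r" for r i
    using spec[OF fam, of r] psd_flag_antimono[OF fl that] by (auto simp: flag_vector_def)
  have diag: "(e r \<bullet> (A (p r) *v e s) > 0 \<longleftrightarrow> r = s) \<and> (e r \<bullet> (A (p r) *v e s) = 0 \<longleftrightarrow> r \<noteq> s)"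
    if "p r \<le> p s" for r s
  proof -
    obtain c where c: "c > 0" "\<forall>w\<in>L (p r). f r \<bullet> w = c * (e r \<bullet> (A (p r) *v w))"
      using spec[OF fam, of r] by (auto simp: flag_vector_def)
    then have "1 / c * (f r \<bullet> e s) = e r \<bullet> (A (p r) *v e s)" using inL[OF that] by simp
    then have "e r \<bullet> (A (p r) *v e s) = (if r = s then 1 / c else 0)"
      using bi by (cases "r = s") (simp_all add: biorthogonal_def)
    then show ?thesis using c(1) by simp
  qed
  have symA: "e r \<bullet> (A i *v e s) = e s \<bullet> (A i *v e r)" if "i < K" for i r s
    using inner_matrix_sym[of "A i"] fl that by (simp add: psd_flag_def)
  have zero: "e r \<bullet> (A i *v e s) = 0"
    if "i < K" "i \<le> p r" "i \<le> p s" "\<not> (p r = i \<and> p s = i \<and> r = s)" for i r s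
  proof (cases "p r = i")
    case True
    then show ?thesis using diag[of r s] that by auto
  next
    case False
    then have "e r \<in> L (Suc i)" using that by (intro inL) simp
    then show ?thesis using psd_flag_kernel(1)[OF fl that(1) _ inL] that by simp
  qed
  have notin: "r \<notin> (\<Union>j<i. Ps ! j) \<longleftrightarrow> i \<le> p r" if "i < length Ms" for i r
    using that by (fastforce simp: Ps_def not_less)
  have "sd_echelon_with (map (\<lambda>M. (\<chi> r. e r) ** M ** transpose (\<chi> r. e r)) Ms) Ps"
    unfolding sd_echelon_with_def
  proof (intro conjI allI impI ballI)
    fix i r s assume i: "i < length (map (\<lambda>M. (\<chi> r. e r) ** M ** transpose (\<chi> r. e r)) Ms)"
      and rs: "r \<notin> (\<Union>j<i. Ps ! j)" "s \<notin> (\<Union>j<i. Ps ! j)" "\<not> (r \<in> Ps ! i \<and> s \<in> Ps ! i)"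
    have "i \<le> p r" "i \<le> p s" using rs notin[of i] i by auto
    moreover have "\<not> (p r = i \<and> p s = i)" using rs(3) i by (simp add: Ps_def)
    ultimately have "e r \<bullet> (A i *v e s) = 0" using i Ms(1) by (intro zero) auto
    then show "map (\<lambda>M. (\<chi> r. e r) ** M ** transpose (\<chi> r. e r)) Ms ! i $ r $ s = 0"
      using i Ms(3) by (simp add: row_congruence_nth)
  qed (use Ms zero diag in \<open>auto simp: Ps_def row_congruence_nth intro!: congruence_sym\<close>)
  then show ?thesis by (auto simp: sd_echelon_def)
qed

text \<open>The solutions use the dual basis, with the roles of \<open>e\<close> and
  \<open>f\<close> exchanged. Biorthogonality makes \<open>F\<close> the inverse of
  \<open>transpose E\<close>, so these are \<open>T'\<close> and \<open>T\<close>.\<close>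

lemma sd_echelon_common_basis:
  fixes As Xs :: "(real^'n^'n) list"
  assumes "face_seq UNIV As" "set As \<subseteq> sym_mats" "face_seq UNIV Xs" "set Xs \<subseteq> sym_mats"
  obtains T T' :: "real^'n^'n" where "T ** T' = mat 1" "T' ** T = mat 1"
    "sd_echelon (map (\<lambda>A. transpose T ** A ** T) As)"
    "sd_echelon (map (\<lambda>X. T' ** X ** transpose T') Xs)"
proof -
  note flA = psd_flag_face_seq[OF assms(1,2)] and flX = psd_flag_face_seq[OF assms(3,4)]
  obtain e f :: "'n \<Rightarrow> real^'n" and p q where bi: "biorthogonal UNIV e f"
    and famA: "\<forall>r. p r < length As + 1 \<and> flag_vector (\<lambda>i. (As @ [mat 1]) ! i)
      (\<lambda>i. {v. \<forall>j<i. v \<bullet> ((As @ [mat 1]) ! j *v v) = 0}) (p r) (e r) (f r)"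
    and famX: "\<forall>r. q r < length Xs + 1 \<and> flag_vector (\<lambda>i. (Xs @ [mat 1]) ! i)
      (\<lambda>i. {v. \<forall>j<i. v \<bullet> ((Xs @ [mat 1]) ! j *v v) = 0}) (q r) (f r) (e r)"
    by (rule two_flags_basis[OF flA flX])
  have bi': "biorthogonal UNIV f e" using bi by (auto simp: biorthogonal_def inner_commute)
  define E :: "real^'n^'n" where "E = (\<chi> r. e r)"
  define F :: "real^'n^'n" where "F = (\<chi> r. f r)"
  have "F ** transpose E = mat 1"
    using bi by (simp add: vec_eq_iff E_def F_def matrix_matrix_mult_def transpose_def mat_def
        biorthogonal_def inner_vec_def)
  then have "F ** transpose E = mat 1" "transpose E ** F = mat 1"
    by (simp_all add: matrix_left_right_inverse)
  moreover have "sd_echelon (map (\<lambda>A. E ** A ** transpose E) As)" unfolding E_def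
    by (rule sd_echelon_flag_basis[OF flA bi famA]) (use assms in \<open>auto simp: nth_append\<close>)
  moreover have "sd_echelon (map (\<lambda>X. F ** X ** transpose F) Xs)" unfolding F_def
    by (rule sd_echelon_flag_basis[OF flX bi' famX]) (use assms in \<open>auto simp: nth_append\<close>)
  ultimately show ?thesis using that[of "transpose E" F] by simp
qed

section \<open>Row operations and rank-one sums\<close>

text \<open>The factor \<open>t\<close> homogenises the system: 1 gives its solutions, 0 its
  recession directions, and the symmetric pairs \<open>(X, t)\<close> form a subspace.\<close>

definition sat :: "real \<Rightarrow> 'n::finite sdp \<Rightarrow> real^'n^'n \<Rightarrow> bool" where
  "sat t S X \<longleftrightarrow> (\<forall>c\<in>set S. mat_dot (fst c) X = t * snd c)"

lemma sat_1: "sat 1 S X \<longleftrightarrow> lhs S X = rhs S"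
  by (auto simp: sat_def lhs_def rhs_def)

lemma sat_0: "sat 0 S X \<longleftrightarrow> lhs S X = replicate (length S) 0"
  unfolding sat_def lhs_def by (induction S) auto

section \<open>The trace pairing\<close>

lemma mat_dot_sum: "mat_dot A X = (\<Sum>r\<in>UNIV. \<Sum>s\<in>UNIV. A $ r $ s * X $ s $ r)"
  by (simp add: mat_dot_def trace_def matrix_matrix_mult_def)

lemma mat_dot_add_left: "mat_dot (A + B) X = mat_dot A X + mat_dot B X"
  by (simp add: mat_dot_sum sum.distrib algebra_simps)

lemma mat_dot_scale_left: "mat_dot (c *\<^sub>R A) X = c * mat_dot A X" for A :: "real^'n^'n"
  by (simp add: mat_dot_sum sum_distrib_left algebra_simps)

lemma mat_dot_inner: "A \<in> sym_mats \<Longrightarrow> mat_dot A X = A \<bullet> X"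
proof -
  assume "A \<in> sym_mats"
  then have "A $ r $ s = A $ s $ r" for r s
    by (metis (mono_tags, lifting) mem_Collect_eq sym_mats_def transpose_def vec_lambda_beta)
  then have "mat_dot A X = (\<Sum>r\<in>UNIV. \<Sum>s\<in>UNIV. A $ s $ r * X $ s $ r)" by (simp add: mat_dot_sum)
  also have "\<dots> = A \<bullet> X" by (simp add: inner_vec_def) (rule sum.swap)
  finally show ?thesis .
qed

lemma mat_dot_congruence: "mat_dot (transpose T ** A ** T) X = mat_dot A (T ** X ** transpose T)"
proof -
  have "trace (transpose T ** (A ** T ** X)) = trace (A ** T ** X ** transpose T)"
    by (rule trace_mul_sym)
  then show ?thesis by (simp add: mat_dot_def matrix_mul_assoc)
qed

text \<open>Unlike \<^const>\<open>reform_step\<close>, row equivalence admits scaling a row of a system with a single row.\<close>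

inductive row_equiv :: "'n::finite sdp \<Rightarrow> 'n sdp \<Rightarrow> bool" where
  refl: "row_equiv S S"
| trans: "row_equiv S S' \<Longrightarrow> row_equiv S' S'' \<Longrightarrow> row_equiv S S''"
| Cons: "row_equiv S S' \<Longrightarrow> row_equiv (c # S) (c # S')"
| swap: "row_equiv (c # d # S) (d # c # S)"
| add: "row_equiv (c # d # S) ((c + mu *\<^sub>R d) # d # S)"
| scale: "lam \<noteq> 0 \<Longrightarrow> row_equiv (c # S) (lam *\<^sub>R c # S)"

lemmas [trans] = row_equiv.trans

lemma row_equiv_length: "row_equiv S S' \<Longrightarrow> length S' = length S"
  by (induction rule: row_equiv.induct) auto

lemma row_equiv_sat: "row_equiv S S' \<Longrightarrow> sat t S' X \<longleftrightarrow> sat t S X"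
  by (induction rule: row_equiv.induct)
     (auto simp: sat_def mat_dot_add_left mat_dot_scale_left algebra_simps)

lemma sym_mats_add: "A \<in> sym_mats \<Longrightarrow> B \<in> sym_mats \<Longrightarrow> A + B \<in> sym_mats"
  and sym_mats_scale: "A \<in> sym_mats \<Longrightarrow> c *\<^sub>R A \<in> sym_mats"
  and sym_mats_0: "0 \<in> sym_mats" and sym_mats_1: "mat 1 \<in> sym_mats" for A B :: "real^'n^'n"
  by (auto simp: sym_mats_def transpose_def vec_eq_iff mat_def)

lemma row_equiv_sym: "row_equiv S S' \<Longrightarrow> set (map fst S) \<subseteq> sym_mats \<Longrightarrow> set (map fst S') \<subseteq> sym_mats"
  by (induction rule: row_equiv.induct) (auto simp: sym_mats_add sym_mats_scale)

lemma reformulation_trans: "reformulation S S' \<Longrightarrow> reformulation S' S'' \<Longrightarrow> reformulation S S''"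
  unfolding reformulation_def by (rule rtranclp_trans)

text \<open>The prefix \<open>R\<close> lets an operation at the head of a list act at any position.
  Two rows are required because scaling is available only as a combination with another row, taken
  with coefficient 0.\<close>

lemma row_equiv_reformulation:
  "row_equiv S S' \<Longrightarrow> 2 \<le> length (R @ S) \<Longrightarrow> reformulation (R @ S) (R @ S')"
proof (induction arbitrary: R rule: row_equiv.induct)
  case (refl S)
  then show ?case by (simp add: reformulation_def)
next
  case (trans S S' S'')
  then show ?case using row_equiv_length[OF trans(1)] reformulation_trans by fastforce
next
  case (Cons S S' c)
  from Cons.IH[of "R @ [c]"] Cons.prems show ?case by simp
next
  case (swap c d S)
  have "reform_step (R @ c # d # S) ((R @ c # d # S)[length R := (R @ c # d # S) ! Suc (length R),
      Suc (length R) := (R @ c # d # S) ! length R])"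
    by (rule reform_step.exchange) auto
  then show ?case by (simp add: list_update_append nth_append reformulation_def r_into_rtranclp)
next
  case (add c d S mu)
  have "reform_step (R @ c # d # S) ((R @ c # d # S)[length R :=
     1 *\<^sub>R ((R @ c # d # S) ! length R) + mu *\<^sub>R ((R @ c # d # S) ! Suc (length R))])"
    by (rule reform_step.combine) auto
  then show ?case by (simp add: list_update_append nth_append reformulation_def r_into_rtranclp)
next
  case (scale lam c S)
  define j where "j = (if R = [] then 1 else 0::nat)"
  have "reform_step (R @ c # S) ((R @ c # S)[length R :=
     lam *\<^sub>R ((R @ c # S) ! length R) + 0 *\<^sub>R ((R @ c # S) ! j)])"
    by (rule reform_step.combine) (use scale in \<open>auto simp: j_def\<close>)
  then show ?case by (simp add: list_update_append nth_append reformulation_def r_into_rtranclp)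
qed

text \<open>Elimination: split \<open>z\<close> into \<open>w\<close> from the span of the tail and
  a multiple of \<open>a\<close>, bring \<open>w\<close> to the head of the tail by induction, then
  swap and add. For \<open>w = 0\<close> scaling \<open>a\<close> suffices.\<close>

lemma row_equiv_first_row:
  assumes "z \<in> span (set S)" "z \<noteq> 0"
  obtains S' where "row_equiv S (z # S')"
  using assms
proof (induction S arbitrary: z thesis)
  case Nil
  then show ?case by simp
next
  case (Cons a S)
  from Cons.prems(2) obtain k where k: "z - k *\<^sub>R a \<in> span (set S)"
    by (auto simp: span_breakdown_eq)
  define w where "w = z - k *\<^sub>R a"
  have z: "z = w + k *\<^sub>R a" by (simp add: w_def)
  show ?case
  proof (cases "w = 0")
    case True
    then have "k \<noteq> 0" "z = k *\<^sub>R a" using z Cons.prems(3) by auto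
    then show ?thesis using Cons.prems(1) row_equiv.scale by blast
  next
    case False
    then obtain S' where "row_equiv S (w # S')" using Cons.IH k by (metis w_def)
    then have "row_equiv (a # S) (a # w # S')" by (rule row_equiv.Cons)
    also have "row_equiv \<dots> (w # a # S')" by (rule row_equiv.swap)
    also have "row_equiv \<dots> (z # a # S')" unfolding z by (rule row_equiv.add)
    finally show ?thesis by (rule Cons.prems(1))
  qed
qed

section \<open>Rank-one matrices and the cones they generate\<close>

definition outer :: "real^'n \<Rightarrow> real^'n^'n" where
  "outer v = (\<chi> r s. v $ r * v $ s)"

lemma inner_outer: "A \<bullet> outer v = v \<bullet> (A *v v)"
  by (simp add: outer_def inner_vec_def matrix_vector_mult_def sum_distrib_left algebra_simps)

lemma outer_scale: "outer (c *\<^sub>R v) = (c * c) *\<^sub>R outer v"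
  by (simp add: outer_def vec_eq_iff)

text \<open>For a subspace \<open>L\<close> this is the face of \<open>psd\<close> of matrices with
  range in \<open>L\<close>, given by generators so that a linear functional on it is tested on
  single vectors of \<open>L\<close>.\<close>

definition outer_sums :: "(real^'n) set \<Rightarrow> (real^'n^'n) set" where
  "outer_sums L = {sum_list (map outer vs) | vs. set vs \<subseteq> L}"

lemma outer_sums_0: "0 \<in> outer_sums L"
  by (auto simp: outer_sums_def intro!: exI[of _ "[]"])

lemma outer_sums_outer: "v \<in> L \<Longrightarrow> outer v \<in> outer_sums L"
  by (auto simp: outer_sums_def intro!: exI[of _ "[v]"])

lemma outer_sums_mono: "L \<subseteq> L' \<Longrightarrow> outer_sums L \<subseteq> outer_sums L'"
  by (auto simp: outer_sums_def)

lemma outer_sums_add: "X \<in> outer_sums L \<Longrightarrow> Y \<in> outer_sums L \<Longrightarrow> X + Y \<in> outer_sums L"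
  unfolding outer_sums_def by clarsimp (metis map_append set_append sum_list_append Un_least)

lemma outer_sums_scale:
  assumes "subspace L" "X \<in> outer_sums L" "0 \<le> c"
  shows "c *\<^sub>R X \<in> outer_sums L"
proof -
  obtain vs where vs: "X = sum_list (map outer vs)" "set vs \<subseteq> L" using assms by (auto simp: outer_sums_def)
  have "c *\<^sub>R X = sum_list (map outer (map ((*\<^sub>R) (sqrt c)) vs))"
    unfolding vs(1) using assms(3) by (induction vs) (simp_all add: outer_scale scaleR_add_right)
  moreover have "set (map ((*\<^sub>R) (sqrt c)) vs) \<subseteq> L" using vs assms by (auto simp: subspace_scale)
  ultimately show ?thesis unfolding outer_sums_def by blast
qed

lemma outer_sums_psd: "outer_sums L \<subseteq> psd"
proof
  fix X assume "X \<in> outer_sums L"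
  then obtain vs where vs: "X = sum_list (map outer vs)" by (auto simp: outer_sums_def)
  have "0 \<in> psd" by (simp add: psd_def sym_mats_0)
  moreover have "outer v \<in> psd" for v :: "real^'n"
  proof -
    have "w \<bullet> (outer v *v w) = (w \<bullet> v)\<^sup>2" for w
      by (simp add: outer_def matrix_vector_mult_def inner_vec_def power2_eq_square sum_product
          sum_distrib_left algebra_simps)
    then show ?thesis by (simp add: psd_def sym_mats_def outer_def transpose_def mult.commute)
  qed
  moreover have "X + Y \<in> psd" if "X \<in> psd" "Y \<in> psd" for X Y :: "real^'n^'n"
    using that by (auto simp: psd_def sym_mats_add matrix_vector_mult_add_rdistrib inner_add_right)
  ultimately show "X \<in> psd" unfolding vs by (induction vs) auto
qed

lemma sum_list_inner: "A \<bullet> sum_list (map f vs) = sum_list (map (\<lambda>v. A \<bullet> f v) vs)"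
  for A :: "'a::real_inner"
  by (induction vs) (simp_all add: inner_add_right)

section \<open>Certificates of infeasibility\<close>

lemma subspace_form_kernel:
  fixes M :: "real^'n^'n"
  assumes "subspace L" "M \<in> sym_mats" "\<forall>v\<in>L. 0 \<le> v \<bullet> (M *v v)"
  shows "subspace {v \<in> L. v \<bullet> (M *v v) = 0}"
  by (rule psd_form_kernel_subspace[OF bilinear_matrix])
     (use assms in \<open>auto simp: sym_mats_def inner_matrix_sym\<close>)

text \<open>\<open>V\<close> consists of pairs \<open>(X, - t)\<close> solving the homogenised
  equations; a point of \<open>K\<close> in it would give the solution \<open>X / t\<close>. A
  separating functional vanishes on \<open>V\<close>, so it is a combination of rows. Small
  \<open>t\<close> yields semidefiniteness on \<open>L\<close>, and \<open>X = 0\<close> the sign of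
  \<open>\<beta>\<close>. Separation need not be strict, so \<open>\<beta> = 0\<close> can
  occur.\<close>

lemma row_separation:
  fixes S :: "'n::finite sdp"
  assumes sym: "set (map fst S) \<subseteq> sym_mats" and L: "subspace L"
    and inf: "\<And>X. X \<in> outer_sums L \<Longrightarrow> \<not> sat 1 S X"
  obtains Z \<beta> where "(Z, \<beta>) \<in> span (set S)" "(Z, \<beta>) \<noteq> 0" "\<beta> \<le> 0" "\<forall>v\<in>L. 0 \<le> v \<bullet> (Z *v v)"
proof -
  define V where "V = {x :: (real^'n^'n) \<times> real. \<forall>c\<in>set S. c \<bullet> x = 0}"
  define K :: "((real^'n^'n) \<times> real) set" where "K = {(X, - t) | X t. X \<in> outer_sums L \<and> 0 < t}"
  have V: "subspace V" by (auto simp: V_def subspace_def inner_add_right)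
  have "convex K"
  proof (rule convexI)
    fix x y :: "(real^'n^'n) \<times> real" and u w :: real
    assume "x \<in> K" "y \<in> K" and uw: "0 \<le> u" "0 \<le> w" "u + w = 1"
    then obtain X s Y t where xy: "x = (X, - s)" "X \<in> outer_sums L" "0 < s"
      "y = (Y, - t)" "Y \<in> outer_sums L" "0 < t" by (auto simp: K_def)
    have "0 < u * s + w * t"
    proof (cases "u = 0")
      case True
      then show ?thesis using uw xy by simp
    next
      case False
      then show ?thesis using uw xy by (simp add: add_pos_nonneg)
    qed
    then show "u *\<^sub>R x + w *\<^sub>R y \<in> K"
      unfolding K_def xy using uw xy
      by (intro CollectI exI[of _ "u *\<^sub>R X + w *\<^sub>R Y"] exI[of _ "u * s + w * t"])
         (auto intro!: outer_sums_add outer_sums_scale L)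
  qed
  moreover have "V \<inter> K = {}"
  proof (rule ccontr)
    assume "V \<inter> K \<noteq> {}"
    then obtain X t where Xt: "(X, - t) \<in> V" "X \<in> outer_sums L" "0 < t" by (auto simp: K_def)
    have "sat 1 S ((1 / t) *\<^sub>R X)" unfolding sat_def
    proof
      fix c assume c: "c \<in> set S"
      then have "fst c \<in> sym_mats" using sym by auto
      moreover have "fst c \<bullet> X = snd c * t" using Xt(1) c by (auto simp: V_def inner_prod_def)
      ultimately show "mat_dot (fst c) ((1 / t) *\<^sub>R X) = 1 * snd c" using Xt by (simp add: mat_dot_inner)
    qed
    then show False using inf outer_sums_scale[OF L Xt(2), of "1 / t"] Xt(3) by simp
  qed
  moreover have "(0, - 1) \<in> K" using outer_sums_0[of L] by (force simp: K_def)
  ultimately obtain a b where a: "a \<noteq> 0" and aV: "\<forall>x\<in>V. a \<bullet> x \<le> b" and aK: "\<forall>x\<in>K. b \<le> a \<bullet> x"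
    using separating_hyperplane_sets[of V K] subspace_imp_convex[OF V] subspace_0[OF V] by blast
  have aV0: "a \<bullet> x = 0" if "x \<in> V" for x
  proof (rule ccontr)
    assume ne: "a \<bullet> x \<noteq> 0"
    have "((b + 1) / (a \<bullet> x)) *\<^sub>R x \<in> V" using V that by (simp add: subspace_scale)
    with aV have "a \<bullet> (((b + 1) / (a \<bullet> x)) *\<^sub>R x) \<le> b" by blast
    then show False using ne by simp
  qed
  have b: "0 \<le> b" using aV subspace_0[OF V] by fastforce
  obtain Z \<beta> where Z: "a = (Z, \<beta>)" by fastforce
  have ineq: "\<beta> * t \<le> Z \<bullet> X" if "X \<in> outer_sums L" "0 < t" for X t
  proof -
    have "(X, - t) \<in> K" using that by (auto simp: K_def)
    then show ?thesis using aK b Z by fastforce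
  qed
  have \<beta>: "\<beta> \<le> 0" using ineq[OF outer_sums_0, of 1] by simp
  have "0 \<le> v \<bullet> (Z *v v)" if v: "v \<in> L" for v
  proof (rule ccontr)
    assume neg: "\<not> 0 \<le> v \<bullet> (Z *v v)"
    define q where "q = v \<bullet> (Z *v v)"
    have *: "\<beta> * t \<le> q" if "0 < t" for t
      using ineq[OF outer_sums_outer[OF v] that] by (simp add: inner_outer q_def)
    have "\<beta> < 0" using *[of 1] neg \<beta> by (simp add: q_def)
    \<comment> \<open>Both \<open>q\<close> and \<open>\<beta>\<close> are negative, so this
      \<open>t\<close> is positive and turns the bound into \<open>q / 2 \<le> q\<close>.\<close>
    then show False using *[of "q / (2 * \<beta>)"] neg by (simp add: q_def divide_neg_neg)
  qed
  moreover have "a \<in> span (set S)"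
    by (rule double_orthogonal[OF subspace_span], rule aV0) (auto simp: V_def span_base)
  ultimately show ?thesis using that a \<beta> Z by blast
qed

text \<open>A separating row may vanish on \<open>L\<close> (this is why echelon blocks may be empty), so the induction is
  on the number of rows rather than on the dimension of \<open>L\<close>.\<close>

lemma infeasibility_certificate:
  fixes S :: "'n::finite sdp"
  assumes "set (map fst S) \<subseteq> sym_mats" "subspace L" "\<And>X. X \<in> outer_sums L \<Longrightarrow> \<not> sat 1 S X"
  shows "\<exists>S' k. row_equiv S S' \<and> k < length S' \<and> face_seq L (take (k + 1) (map fst S')) \<and>
    (\<forall>i<k. rhs S' ! i = 0) \<and> rhs S' ! k = -1"
  using assms
proof (induction "length S" arbitrary: S L rule: less_induct)
  case less
  obtain Z \<beta> where Z: "(Z, \<beta>) \<in> span (set S)" "(Z, \<beta>) \<noteq> 0" "\<beta> \<le> 0" "\<forall>v\<in>L. 0 \<le> v \<bullet> (Z *v v)"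
    using row_separation[OF less.prems] by blast
  show ?case
  proof (cases "\<beta> = 0")
    case False
    define c where "c = 1 / - \<beta>"
    have c: "0 < c" using Z(3) False by (simp add: c_def)
    define z where "z = c *\<^sub>R (Z, \<beta>)"
    have "z \<in> span (set S)" "z \<noteq> 0"
      using span_scale[OF Z(1), of c] False c by (auto simp: z_def zero_prod_def)
    then obtain S' where S': "row_equiv S (z # S')" by (rule row_equiv_first_row)
    have "v \<bullet> (fst z *v v) = c * (v \<bullet> (Z *v v))" for v
      by (simp add: z_def scaleR_matrix_vector_assoc[symmetric])
    then have "\<forall>v\<in>L. 0 \<le> v \<bullet> (fst z *v v)"
      using Z(4) c by simp
    moreover have "snd z = -1" using False by (simp add: z_def c_def)
    ultimately show ?thesis using S'
      by (intro exI[of _ "z # S'"] exI[of _ 0]) (simp add: face_seq_Cons face_seq_Nil rhs_def)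
  next
    case True
    obtain S' where S': "row_equiv S ((Z, 0) # S')"
      using row_equiv_first_row[OF Z(1,2)] True by blast
    have len: "length S' < length S" using row_equiv_length[OF S'] by simp
    have sym: "Z \<in> sym_mats" "set (map fst S') \<subseteq> sym_mats"
      using row_equiv_sym[OF S' less.prems(1)] by auto
    \<comment> \<open>The row \<open>(Z, 0)\<close> holds automatically for sums of rank-one
      matrices from \<open>L'\<close>, so the remaining rows are infeasible over the smaller
      face.\<close>
    define L' where "L' = {v \<in> L. v \<bullet> (Z *v v) = 0}"
    have L': "subspace L'" unfolding L'_def by (rule subspace_form_kernel[OF less.prems(2) sym(1) Z(4)])
    have "\<not> sat 1 S' X" if X: "X \<in> outer_sums L'" for X
    proof
      assume sat: "sat 1 S' X"
      obtain vs where vs: "X = sum_list (map outer vs)" "set vs \<subseteq> L'" using X by (auto simp: outer_sums_def)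
      have "map (\<lambda>v. Z \<bullet> outer v) vs = map (\<lambda>v. 0) vs"
        using vs(2) by (auto simp: inner_outer L'_def)
      then have "mat_dot Z X = sum_list (map (\<lambda>v. 0) vs)"
        unfolding mat_dot_inner[OF sym(1)] vs(1) sum_list_inner by (rule arg_cong)
      then have "mat_dot Z X = 0" by simp
      then have "sat 1 S X" using sat row_equiv_sat[OF S', of 1 X] by (simp add: sat_def)
      then show False using less.prems(3) outer_sums_mono[of L' L] X by (auto simp: L'_def)
    qed
    from less.hyps[OF len sym(2) L' this] obtain S'' k where S'': "row_equiv S' S''" "k < length S''"
      "face_seq L' (take (k + 1) (map fst S''))" "\<forall>i<k. rhs S'' ! i = 0" "rhs S'' ! k = -1" by blast
    have "row_equiv S ((Z, 0) # S'')" by (rule row_equiv.trans[OF S' row_equiv.Cons[OF S''(1)]])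
    then show ?thesis using S'' Z(4)
      by (intro exI[of _ "(Z, 0) # S''"] exI[of _ "Suc k"])
         (auto simp: face_seq_Cons L'_def rhs_def nth_Cons split: nat.splits)
  qed
qed

section \<open>Nearly positive semidefinite solutions\<close>

lemma mat_dot_add_right: "mat_dot A (X + Y) = mat_dot A X + mat_dot A Y"
  by (simp add: mat_dot_sum sum.distrib algebra_simps)

lemma mat_dot_scale_right: "mat_dot A (c *\<^sub>R X) = c * mat_dot A X"
  by (simp add: mat_dot_sum sum_distrib_left algebra_simps)

lemma sat_add: "sat s S X \<Longrightarrow> sat t S Y \<Longrightarrow> sat (s + t) S (X + Y)"
  by (simp add: sat_def mat_dot_add_right algebra_simps)

lemma sat_scale: "sat t S X \<Longrightarrow> sat (c * t) S (c *\<^sub>R X)"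
  by (simp add: sat_def mat_dot_scale_right)

lemma subspace_sat: "subspace {(X, t). X \<in> sym_mats \<and> sat t S X}"
  unfolding subspace_def
  using sat_add sat_scale
  by (auto simp: sym_mats_0 sym_mats_add sym_mats_scale zero_prod_def)
     (simp add: sat_def mat_dot_sum)

lemma inner_matrix_congruence: "v \<bullet> ((transpose B ** A ** B) *v v) = (B *v v) \<bullet> (A *v (B *v v))"
  for A B :: "real^'n^'n"
  by (metis dot_lmul_matrix matrix_vector_mul_assoc transpose_transpose vector_transpose_matrix)

lemma sym_mats_form_zero:
  fixes M :: "real^'n^'n"
  assumes M: "M \<in> sym_mats" and z: "\<And>v. v \<bullet> (M *v v) = 0"
  shows "M = 0"
proof -
  have "x \<bullet> (M *v y) = 0" for x y
    by (rule psd_form_zero[OF bilinear_matrix subspace_UNIV])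
       (use M z in \<open>auto simp: sym_mats_def inner_matrix_sym\<close>)
  then have "M *v y = 0" for y by (metis inner_eq_zero_iff)
  then show ?thesis by (simp add: matrix_eq)
qed

lemma form_add: "v \<bullet> ((A + B) *v v) = v \<bullet> (A *v v) + v \<bullet> (B *v v)"
  and form_scale: "v \<bullet> ((c *\<^sub>R A) *v v) = c * (v \<bullet> (A *v v))" for A B :: "real^'n^'n"
  by (simp_all add: matrix_vector_mult_add_rdistrib inner_add_right scaleR_matrix_vector_assoc[symmetric])

lemma continuous_form: "continuous_on UNIV (\<lambda>A. v \<bullet> (A *v v))" for v :: "real^'n"
  by (intro linear_continuous_on_compose[OF continuous_on_id])
     (simp add: linear_iff form_add form_scale)

text \<open>Distance zero to the cone in terms of quadratic forms, a version that can be restricted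
  to a subspace.\<close>

definition nearly_psd :: "(real^'n) set \<Rightarrow> 'n::finite sdp \<Rightarrow> bool" where
  "nearly_psd L S \<longleftrightarrow> (\<forall>\<epsilon>>0. \<exists>X\<in>sym_mats. sat 1 S X \<and> (\<forall>v\<in>L. - \<epsilon> * (v \<bullet> v) \<le> v \<bullet> (X *v v)))"

text \<open>Compactness in the homogenised space of pairs \<open>(X, t)\<close>: a limit with \<open>t > 0\<close> gives a
  solution, and a limit with \<open>t = 0\<close> is a recession direction, which is excluded.\<close>

lemma nearly_psd_attained:
  fixes S :: "'n::finite sdp"
  assumes L: "subspace L" and near: "nearly_psd L S"
    and rec: "\<And>Y. Y \<in> sym_mats \<Longrightarrow> sat 0 S Y \<Longrightarrow> \<forall>v\<in>L. 0 \<le> v \<bullet> (Y *v v) \<Longrightarrow> \<forall>v\<in>L. v \<bullet> (Y *v v) = 0"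
  shows "\<exists>X\<in>sym_mats. sat 1 S X \<and> (\<forall>v\<in>L. 0 \<le> v \<bullet> (X *v v))"
proof -
  \<comment> \<open>The matrices may diverge even after normalisation; only their forms on
    \<open>L\<close> are controlled. \<open>R\<close> records these through a linear map
    \<open>g\<close> onto \<open>L\<close>. The image \<open>V\<close> is closed, being a subspace,
    so the limit again comes from some \<open>Y\<close>.\<close>
  obtain g :: "real^'n \<Rightarrow> real^'n" where g: "range g \<subseteq> L" "linear g" "\<forall>v\<in>L. g v = v"
    using linear_exists_left_inverse_on[of id L] L by (auto simp: linear_id)
  define B where "B = matrix g"
  have B: "B *v v = g v" for v using g(2) by (simp add: B_def)
  define R where "R = (\<lambda>(X :: real^'n^'n, t :: real). (transpose B ** X ** B, t))"
  have "linear R" unfolding linear_iff R_def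
    by (auto simp: vec_eq_iff matrix_matrix_mult_def sum.distrib sum_distrib_left sum_distrib_right algebra_simps)
  define V where "V = R ` {(X, t). X \<in> sym_mats \<and> sat t S X}"
  have V: "subspace V" unfolding V_def
    by (rule linear_subspace_image[OF \<open>linear R\<close> subspace_sat])
  have "\<exists>X\<in>sym_mats. sat 1 S X \<and> (\<forall>v\<in>L. - inverse (Suc n) * (v \<bullet> v) \<le> v \<bullet> (X *v v))" for n
    using near by (auto simp: nearly_psd_def)
  then obtain X where X: "\<And>n. X n \<in> sym_mats" "\<And>n. sat 1 S (X n)"
    "\<And>n v. v \<in> L \<Longrightarrow> - inverse (Suc n) * (v \<bullet> v) \<le> v \<bullet> (X n *v v)" by metis
  define z where "z n = R (X n, 1) /\<^sub>R norm (R (X n, 1))" for n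
  \<comment> \<open>The component 1 bounds the norm from below, so normalising does not worsen the
    lower bound on the form.\<close>
  have norm1: "1 \<le> norm (R (X n, 1))" for n
    using norm_snd_le[of "snd (R (X n, 1))" "fst (R (X n, 1))"] by (simp add: R_def)
  then have nz: "R (X n, 1) \<noteq> 0" for n by (metis norm_zero not_one_le_zero)
  have "R (X n, 1) \<in> V" for n using X by (auto simp: V_def)
  then have "z n \<in> V \<inter> sphere 0 1" for n using V nz by (simp add: z_def subspace_scale)
  moreover have "compact (V \<inter> sphere 0 1)"
    by (intro closed_Int_compact closed_subspace V compact_sphere)
  ultimately obtain l r where l: "l \<in> V \<inter> sphere 0 1" and r: "strict_mono r" "(z \<circ> r) \<longlonglongrightarrow> l"
    unfolding compact_def by metis
  then obtain Y t where Y: "Y \<in> sym_mats" "sat t S Y" and lY: "l = (transpose B ** Y ** B, t)"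
    by (auto simp: V_def R_def)
  have "0 \<le> t"
  proof (rule LIMSEQ_le_const)
    show "(\<lambda>n. snd ((z \<circ> r) n)) \<longlonglongrightarrow> t" using tendsto_snd[OF r(2)] by (simp add: lY)
    show "\<exists>N. \<forall>n\<ge>N. 0 \<le> snd ((z \<circ> r) n)" by (simp add: z_def R_def)
  qed
  have psdY: "0 \<le> v \<bullet> (Y *v v)" if v: "v \<in> L" for v
  proof (rule LIMSEQ_le)
    show "(\<lambda>n. - (inverse (Suc n) * (v \<bullet> v))) \<longlonglongrightarrow> 0"
      using tendsto_minus[OF tendsto_mult_left_zero[OF LIMSEQ_inverse_real_of_nat, of "v \<bullet> v"]] by simp
    have "(\<lambda>n. v \<bullet> (fst ((z \<circ> r) n) *v v)) \<longlonglongrightarrow> v \<bullet> (fst l *v v)"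
      using continuous_form tendsto_fst[OF r(2)]
      by (rule continuous_on_tendsto_compose) auto
    moreover have "v \<bullet> (fst l *v v) = v \<bullet> (Y *v v)" using g v
      by (simp add: lY inner_matrix_congruence B)
    ultimately show "(\<lambda>n. v \<bullet> (fst ((z \<circ> r) n) *v v)) \<longlonglongrightarrow> v \<bullet> (Y *v v)" by simp
    show "\<exists>N. \<forall>n\<ge>N. - (inverse (Suc n) * (v \<bullet> v)) \<le> v \<bullet> (fst ((z \<circ> r) n) *v v)"
    proof (intro exI allI impI)
      fix n
      let ?m = "norm (R (X (r n), 1))"
      have "v \<bullet> (fst ((z \<circ> r) n) *v v) = (v \<bullet> (X (r n) *v v)) / ?m"
        using g v by (simp add: z_def R_def form_scale inner_matrix_congruence B divide_inverse mult.commute)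
      moreover have "- (inverse (Suc n) * (v \<bullet> v)) \<le> - (inverse (Suc (r n)) * (v \<bullet> v))"
        using seq_suble[OF r(1), of n] by (simp add: mult_right_mono le_imp_inverse_le)
      moreover have "- (inverse (Suc (r n)) * (v \<bullet> v)) \<le> - (inverse (Suc (r n)) * (v \<bullet> v)) / ?m"
        using mult_left_mono[OF norm1[of "r n"], of "inverse (Suc (r n)) * (v \<bullet> v)"] norm1[of "r n"]
        by (simp add: divide_le_eq)
      moreover have "- (inverse (Suc (r n)) * (v \<bullet> v)) / ?m \<le> (v \<bullet> (X (r n) *v v)) / ?m"
        using X(3)[OF v, of "r n"] norm1[of "r n"] by (intro divide_right_mono) auto
      ultimately show "- (inverse (Suc n) * (v \<bullet> v)) \<le> v \<bullet> (fst ((z \<circ> r) n) *v v)" by linarith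
    qed
  qed
  show ?thesis
  proof (cases "t = 0")
    case True
    then have "\<forall>v\<in>L. v \<bullet> (Y *v v) = 0" using rec[OF Y(1)] Y(2) psdY by blast
    then have "v \<bullet> ((transpose B ** Y ** B) *v v) = 0" for v
      using g(1) by (auto simp: inner_matrix_congruence B)
    moreover have "transpose B ** Y ** B \<in> sym_mats" using congruence_sym[OF Y(1), of "transpose B"] by simp
    ultimately have "transpose B ** Y ** B = 0" by (intro sym_mats_form_zero)
    then show ?thesis using l lY True by (simp add: norm_Pair)
  next
    case False
    then show ?thesis using Y psdY \<open>0 \<le> t\<close> sat_scale[OF Y(2), of "1 / t"]
      by (intro bexI[of _ "(1 / t) *\<^sub>R Y"]) (auto simp: form_scale sym_mats_scale)
  qed
qed

text \<open>A recession direction that is semidefinite but not zero on \<open>L\<close> becomes the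
  next member, and its kernel has smaller dimension. When none is left,
  \<open>nearly_psd_attained\<close> supplies the last member.\<close>

lemma nearly_psd_sequence:
  fixes S :: "'n::finite sdp"
  assumes "subspace L" "nearly_psd L S"
  shows "\<exists>Xs X. face_seq L (Xs @ [X]) \<and> (\<forall>Y\<in>set Xs. Y \<in> sym_mats \<and> sat 0 S Y) \<and> X \<in> sym_mats \<and> sat 1 S X"
  using assms
proof (induction "dim L" arbitrary: L rule: less_induct)
  case less
  show ?case
  proof (cases "\<exists>Y\<in>sym_mats. sat 0 S Y \<and> (\<forall>v\<in>L. 0 \<le> v \<bullet> (Y *v v)) \<and> (\<exists>v\<in>L. v \<bullet> (Y *v v) \<noteq> 0)")
    case True
    then obtain Y where Y: "Y \<in> sym_mats" "sat 0 S Y" "\<forall>v\<in>L. 0 \<le> v \<bullet> (Y *v v)" "\<exists>v\<in>L. v \<bullet> (Y *v v) \<noteq> 0"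
      by blast
    define L' where "L' = {v \<in> L. v \<bullet> (Y *v v) = 0}"
    have L': "subspace L'" unfolding L'_def by (rule subspace_form_kernel[OF less.prems(1) Y(1,3)])
    have "L' \<subset> L" using Y(4) by (auto simp: L'_def)
    then have "dim L' < dim L"
      using L' less.prems(1) by (intro dim_psubset) (simp add: span_eq_iff[THEN iffD2])
    moreover have "nearly_psd L' S" using less.prems(2) by (fastforce simp: nearly_psd_def L'_def)
    ultimately obtain Xs X where "face_seq L' (Xs @ [X])" "\<forall>Y\<in>set Xs. Y \<in> sym_mats \<and> sat 0 S Y"
      "X \<in> sym_mats" "sat 1 S X" using less.hyps L' by blast
    then show ?thesis using Y
      by (intro exI[of _ "Y # Xs"] exI[of _ X]) (auto simp: face_seq_Cons L'_def)
  next
    case False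
    then obtain X where "X \<in> sym_mats" "sat 1 S X" "\<forall>v\<in>L. 0 \<le> v \<bullet> (X *v v)"
      using nearly_psd_attained[OF less.prems] by blast
    then show ?thesis by (intro exI[of _ "[]"] exI[of _ X]) (auto simp: face_seq_Cons face_seq_Nil)
  qed
qed

text \<open>If every \<open>c = Suc n\<close> failed, unit vectors would accumulate at some
  \<open>l\<close>; dividing by \<open>Suc n\<close> shows that the form of \<open>N\<close>
  vanishes at \<open>l\<close>, while that of \<open>M\<close> is at most 0 there.\<close>

lemma finsler:
  fixes M N :: "real^'n^'n"
  assumes V: "subspace V" and N: "\<And>v. v \<in> V \<Longrightarrow> 0 \<le> v \<bullet> (N *v v)"
    and M: "\<And>v. v \<in> V \<Longrightarrow> v \<bullet> (N *v v) = 0 \<Longrightarrow> v \<noteq> 0 \<Longrightarrow> 0 < v \<bullet> (M *v v)"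
  shows "\<exists>c. \<forall>v\<in>V. v \<noteq> 0 \<longrightarrow> 0 < v \<bullet> ((M + c *\<^sub>R N) *v v)"
proof (rule ccontr)
  assume "\<not> ?thesis"
  then have "\<exists>v\<in>V. v \<noteq> 0 \<and> v \<bullet> (M *v v) + real (Suc n) * (v \<bullet> (N *v v)) \<le> 0" for n
    by (auto simp: form_add form_scale not_less)
  then obtain v where v: "\<And>n. v n \<in> V" "\<And>n. v n \<noteq> 0"
    "\<And>n. v n \<bullet> (M *v v n) + real (Suc n) * (v n \<bullet> (N *v v n)) \<le> 0" by metis
  define u where "u n = v n /\<^sub>R norm (v n)" for n
  have u: "u n \<in> V" "norm (u n) = 1" for n using v V by (auto simp: u_def subspace_scale)
  have un: "u n \<bullet> (M *v u n) + real (Suc n) * (u n \<bullet> (N *v u n)) \<le> 0" for n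
  proof -
    have "u n \<bullet> (M *v u n) + real (Suc n) * (u n \<bullet> (N *v u n)) =
        (inverse (norm (v n)))\<^sup>2 * (v n \<bullet> (M *v v n) + real (Suc n) * (v n \<bullet> (N *v v n)))"
      by (simp add: u_def matrix_vector_mult_scaleR power2_eq_square algebra_simps)
    then show ?thesis using v(3)[of n] by (simp add: mult_nonneg_nonpos)
  qed
  have "compact (V \<inter> sphere 0 1)" by (intro closed_Int_compact closed_subspace V compact_sphere)
  moreover have "u n \<in> V \<inter> sphere 0 1" for n using u by simp
  ultimately obtain l r where l: "l \<in> V \<inter> sphere 0 1" and r: "strict_mono r" "(u \<circ> r) \<longlonglongrightarrow> l"
    unfolding compact_def by metis
  have lim: "(\<lambda>n. u (r n) \<bullet> (A *v u (r n))) \<longlonglongrightarrow> l \<bullet> (A *v l)" for A :: "real^'n^'n"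
    using r(2) by (intro tendsto_inner bounded_linear.tendsto[OF matrix_vector_mul_bounded_linear])
      (simp_all add: o_def)
  have "l \<bullet> (M *v l) \<le> 0"
  proof (rule LIMSEQ_le_const2[OF lim])
    show "\<exists>m. \<forall>n\<ge>m. u (r n) \<bullet> (M *v u (r n)) \<le> 0"
      using un N u(1) by (smt (verit) mult_nonneg_nonneg of_nat_0_le_iff)
  qed
  moreover have "l \<bullet> (N *v l) \<le> 0"
  proof (rule LIMSEQ_le[OF lim])
    have "(\<lambda>n. inverse (real (Suc (r n)))) \<longlonglongrightarrow> 0"
      using LIMSEQ_subseq_LIMSEQ[OF LIMSEQ_inverse_real_of_nat r(1)] by (simp add: o_def)
    from tendsto_mult[OF this tendsto_minus[OF lim[of M]]]
    show "(\<lambda>n. inverse (real (Suc (r n))) * - (u (r n) \<bullet> (M *v u (r n)))) \<longlonglongrightarrow> 0" by simp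
    show "\<exists>m. \<forall>n\<ge>m. u (r n) \<bullet> (N *v u (r n)) \<le> inverse (real (Suc (r n))) * - (u (r n) \<bullet> (M *v u (r n)))"
    proof (intro exI allI impI)
      fix n
      have "real (Suc (r n)) * (u (r n) \<bullet> (N *v u (r n))) \<le> - (u (r n) \<bullet> (M *v u (r n)))"
        using un[of "r n"] by simp
      then show "u (r n) \<bullet> (N *v u (r n)) \<le> inverse (real (Suc (r n))) * - (u (r n) \<bullet> (M *v u (r n)))"
        by (simp add: field_simps)
    qed
  qed
  ultimately show False using N[of l] M[of l] l by fastforce
qed

text \<open>Built backwards: \<open>X\<close> works on the last kernel, and a suitable multiple of
  each earlier matrix repairs the remaining directions without changing the right-hand side. The
  shift by \<open>\<epsilon>\<close> times the identity supplies the strict positivity that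
  \<open>finsler\<close> asks for.\<close>

lemma face_seq_nearly_psd:
  fixes S :: "'n::finite sdp"
  assumes "face_seq L (Xs @ [X])" "subspace L" "\<forall>Y\<in>set Xs. Y \<in> sym_mats \<and> sat 0 S Y"
    "X \<in> sym_mats" "sat 1 S X"
  shows "nearly_psd L S"
proof -
  have "\<exists>Y\<in>sym_mats. sat 1 S Y \<and> (\<forall>v\<in>L. v \<noteq> 0 \<longrightarrow> 0 < v \<bullet> ((Y + \<epsilon> *\<^sub>R mat 1) *v v))" if "\<epsilon> > 0" for \<epsilon>
    using assms
  proof (induction Xs arbitrary: L)
    case Nil
    then show ?case using that
      by (intro bexI[of _ X]) (auto simp: face_seq_Cons form_add form_scale add_nonneg_pos)
  next
    case (Cons N Xs)
    define L' where "L' = {v \<in> L. v \<bullet> (N *v v) = 0}"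
    have N: "N \<in> sym_mats" "sat 0 S N" "\<forall>v\<in>L. 0 \<le> v \<bullet> (N *v v)" "face_seq L' (Xs @ [X])"
      using Cons.prems by (auto simp: face_seq_Cons L'_def)
    have "subspace L'" unfolding L'_def by (rule subspace_form_kernel[OF Cons.prems(2) N(1,3)])
    then obtain Y where Y: "Y \<in> sym_mats" "sat 1 S Y"
      "\<forall>v\<in>L'. v \<noteq> 0 \<longrightarrow> 0 < v \<bullet> ((Y + \<epsilon> *\<^sub>R mat 1) *v v)"
      using Cons.IH[OF N(4)] Cons.prems by auto
    obtain c where c: "\<forall>v\<in>L. v \<noteq> 0 \<longrightarrow> 0 < v \<bullet> ((Y + \<epsilon> *\<^sub>R mat 1 + c *\<^sub>R N) *v v)"
      using finsler[OF Cons.prems(2), of N "Y + \<epsilon> *\<^sub>R mat 1"] N(3) Y(3) by (auto simp: L'_def)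
    have "sat 1 S (Y + c *\<^sub>R N)" using sat_add[OF Y(2) sat_scale[OF N(2), of c]] by simp
    then show ?case using c Y(1) N(1)
      by (intro bexI[of _ "Y + c *\<^sub>R N"]) (auto simp: add.commute add.left_commute intro!: sym_mats_add sym_mats_scale)
  qed
  then show ?thesis unfolding nearly_psd_def
    by (smt (verit) form_add form_scale inner_zero_left matrix_vector_mul_lid mult_minus_left)
qed

section \<open>Echelon forms and reformulations\<close>

lemma psd_entries:
  assumes "Y \<in> psd"
  shows "0 \<le> Y $ r $ r" "Y $ r $ r = 0 \<Longrightarrow> Y $ r $ s = 0" "Y $ r $ s = Y $ s $ r"
proof -
  have entry: "axis r 1 \<bullet> (Y *v axis s 1) = Y $ r $ s" for r s
    by (simp add: matrix_vector_mult_basis column_def inner_axis')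
  have sym: "transpose Y = Y" and nonneg: "\<And>v. 0 \<le> v \<bullet> (Y *v v)"
    using assms by (auto simp: psd_def sym_mats_def)
  show "0 \<le> Y $ r $ r" using nonneg[of "axis r 1"] by (simp add: entry)
  show "Y $ r $ s = Y $ s $ r" using inner_matrix_sym[OF sym, of "axis r 1" "axis s 1"] by (simp add: entry)
  show "Y $ r $ s = 0" if "Y $ r $ r = 0"
    using psd_form_zero[OF bilinear_matrix subspace_UNIV, of Y "axis r 1" "axis s 1"]
      inner_matrix_sym[OF sym] nonneg that by (auto simp: entry)
qed

text \<open>The arbitrary entries of \<open>Ms ! i\<close> sit in rows and columns of earlier
  blocks, where \<open>Y\<close> vanishes, so only the diagonal of block \<open>i\<close>
  survives.\<close>

lemma sd_echelon_mat_dot: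
  assumes ech: "sd_echelon_with Ms Ps" and i: "i < length Ms"
    and Y: "\<And>r s. r \<in> (\<Union>j<i. Ps ! j) \<Longrightarrow> Y $ r $ s = 0 \<and> Y $ s $ r = 0"
  shows "mat_dot (Ms ! i) Y = (\<Sum>r\<in>Ps ! i. Ms ! i $ r $ r * Y $ r $ r)"
proof -
  have disj: "r \<notin> (\<Union>j<i. Ps ! j)" if "r \<in> Ps ! i" for r
    using ech i that unfolding sd_echelon_with_def
    by clarsimp (metis disjoint_iff less_trans nat_neq_iff)
  have "Ms ! i $ r $ s * Y $ s $ r = (if s = r then if r \<in> Ps ! i then Ms ! i $ r $ r * Y $ r $ r else 0 else 0)" for r s
  proof (cases "r \<in> (\<Union>j<i. Ps ! j) \<or> s \<in> (\<Union>j<i. Ps ! j)")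
    case True
    then show ?thesis using Y[of r s] Y[of s r] disj[of r] by auto
  next
    case False
    then have "\<not> (r \<in> Ps ! i \<and> s \<in> Ps ! i) \<Longrightarrow> Ms ! i $ r $ s = 0"
      "r \<in> Ps ! i \<Longrightarrow> s \<in> Ps ! i \<Longrightarrow> r \<noteq> s \<Longrightarrow> Ms ! i $ r $ s = 0"
      using ech i unfolding sd_echelon_with_def by auto
    then show ?thesis by auto
  qed
  then have "(\<Sum>s\<in>UNIV. Ms ! i $ r $ s * Y $ s $ r) = (if r \<in> Ps ! i then Ms ! i $ r $ r * Y $ r $ r else 0)" for r
    by simp
  then show ?thesis
    by (simp only: mat_dot_sum sum.inter_restrict[OF finite, symmetric] Int_UNIV_left)
qed

text \<open>Zero diagonal entries of \<open>Y\<close> clear their rows and columns, so each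
  vanishing product, a sum with positive weights, rids the next one of its arbitrary entries.
  Besides refuting feasibility, the choice \<open>Y = outer v\<close> yields
  \<open>face_seq\<close>.\<close>

lemma sd_echelon_psd_nonneg:
  assumes ech: "sd_echelon Ms" and Y: "Y \<in> psd" and i: "i < length Ms"
    and zero: "\<And>j. j < i \<Longrightarrow> mat_dot (Ms ! j) Y = 0"
  shows "0 \<le> mat_dot (Ms ! i) Y"
proof -
  obtain Ps where Ps: "sd_echelon_with Ms Ps" using ech by (auto simp: sd_echelon_def)
  have pos: "0 < Ms ! j $ r $ r" if "j < length Ms" "r \<in> Ps ! j" for j r
    using Ps that by (auto simp: sd_echelon_with_def)
  have rows: "\<forall>r\<in>(\<Union>j<k. Ps ! j). Y $ r $ r = 0" if "k \<le> i" for k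
    using that
  proof (induction k)
    case (Suc k)
    have "mat_dot (Ms ! k) Y = (\<Sum>r\<in>Ps ! k. Ms ! k $ r $ r * Y $ r $ r)"
      by (rule sd_echelon_mat_dot[OF Ps]) (use Suc i psd_entries[OF Y] in auto)
    then have "(\<Sum>r\<in>Ps ! k. Ms ! k $ r $ r * Y $ r $ r) = 0" using zero Suc by simp
    moreover have "\<forall>r\<in>Ps ! k. 0 < Ms ! k $ r $ r" using pos Suc i by simp
    moreover then have "0 \<le> Ms ! k $ r $ r * Y $ r $ r" if "r \<in> Ps ! k" for r
      using psd_entries(1)[OF Y] that by (simp add: less_imp_le)
    ultimately have "\<forall>r\<in>Ps ! k. Y $ r $ r = 0"
      by (subst (asm) sum_nonneg_eq_0_iff) fastforce+
    then show ?case using Suc by (auto simp: less_Suc_eq)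
  qed simp
  have "mat_dot (Ms ! i) Y = (\<Sum>r\<in>Ps ! i. Ms ! i $ r $ r * Y $ r $ r)"
    by (rule sd_echelon_mat_dot[OF Ps i]) (use rows[OF order_refl] psd_entries[OF Y] in auto)
  then show ?thesis
    using pos[OF i] psd_entries(1)[OF Y] by (simp add: sum_nonneg less_imp_le)
qed

lemma outer_psd: "outer v \<in> psd"
  using outer_sums_psd outer_sums_outer[of v UNIV] by blast

lemma sd_echelon_face_seq:
  assumes "sd_echelon Ms"
  shows "face_seq UNIV Ms"
proof -
  have "Ms ! i \<in> sym_mats" if "i < length Ms" for i
    using assms that unfolding sd_echelon_def sd_echelon_with_def by auto
  then have "mat_dot (Ms ! i) (outer v) = v \<bullet> (Ms ! i *v v)" if "i < length Ms" for i v
    using that by (simp add: mat_dot_inner inner_outer)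
  then show ?thesis
    using sd_echelon_psd_nonneg[OF assms outer_psd] unfolding face_seq_def by fastforce
qed

text \<open>Cauchy-Schwarz for the pairing of \<open>A\<close> with \<open>outer v\<close>, whose
  Frobenius norm is \<open>v \<bullet> v\<close>.\<close>

lemma abs_form_le: "\<bar>v \<bullet> (A *v v)\<bar> \<le> norm A * (v \<bullet> v)" for A :: "real^'n^'n"
proof -
  have "outer v *v v = (v \<bullet> v) *\<^sub>R v"
    by (simp add: vec_eq_iff outer_def matrix_vector_mult_def inner_vec_def sum_distrib_left
        sum_distrib_right algebra_simps)
  then have "outer v \<bullet> outer v = (v \<bullet> v)\<^sup>2" by (simp add: inner_outer power2_eq_square)
  then have "norm (outer v) = v \<bullet> v" by (simp add: norm_eq_sqrt_inner)
  then show ?thesis using Cauchy_Schwarz_ineq2[of A "outer v"] by (simp add: inner_outer)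
qed

section \<open>Weak infeasibility through quadratic forms\<close>

lemma nearly_psd_shift:
  assumes "nearly_psd UNIV S" "\<epsilon> > 0"
  shows "\<exists>X\<in>sym_mats. sat 1 S X \<and> X + \<epsilon> *\<^sub>R mat 1 \<in> psd"
proof -
  obtain X where X: "X \<in> sym_mats" "sat 1 S X" "\<forall>v. - \<epsilon> * (v \<bullet> v) \<le> v \<bullet> (X *v v)"
    using assms unfolding nearly_psd_def by (metis UNIV_I)
  have "0 \<le> v \<bullet> ((X + \<epsilon> *\<^sub>R mat 1) *v v)" for v
    using X(3)[rule_format, of v] by (simp add: form_add form_scale)
  then show ?thesis using X
    by (intro bexI[of _ X]) (simp_all add: psd_def sym_mats_add sym_mats_scale sym_mats_1)
qed

lemma sd_echelon_nearly_psd: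
  assumes len: "length Xs = l + 1" and ech: "sd_echelon Xs"
    and sat: "\<forall>i<l. sat 0 S (Xs ! i)" "sat 1 S (Xs ! l)"
  shows "nearly_psd UNIV S"
proof (rule face_seq_nearly_psd[OF _ subspace_UNIV _ _ sat(2)])
  have "Xs = take l Xs @ [Xs ! l]" using len take_Suc_conv_app_nth[of l Xs] by simp
  then show "face_seq UNIV (take l Xs @ [Xs ! l])" using sd_echelon_face_seq[OF ech] by simp
  have sym: "Xs ! i \<in> sym_mats" if "i < length Xs" for i
    using ech that by (auto simp: sd_echelon_def sd_echelon_with_def)
  then show "Xs ! l \<in> sym_mats" using len by simp
  show "\<forall>Y\<in>set (take l Xs). Y \<in> sym_mats \<and> sat 0 S Y"
    using sym sat(1) len by (auto simp: in_set_conv_nth)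
qed

text \<open>A positive semidefinite matrix closer than \<open>\<epsilon>\<close> bounds the form
  from below by \<open>abs_form_le\<close>; conversely, a small multiple of the identity shifts a
  solution into \<open>psd\<close> over a proportional distance.\<close>

lemma weakly_infeasible_iff:
  fixes S :: "'n::finite sdp"
  shows "weakly_infeasible S \<longleftrightarrow> (\<forall>X\<in>psd. \<not> sat 1 S X) \<and> nearly_psd UNIV S"
proof (cases "\<forall>X\<in>psd. \<not> sat 1 S X")
  case True
  have "nearly_psd UNIV S" if ne: "affine_set S \<noteq> {}" and sd: "setdist (affine_set S) psd = 0"
    unfolding nearly_psd_def
  proof (intro allI impI)
    fix \<epsilon> :: real assume "\<epsilon> > 0"
    moreover have "psd \<noteq> {}" using outer_psd by blast
    ultimately obtain X Y where X: "X \<in> affine_set S" and Y: "Y \<in> psd" and d: "dist X Y < \<epsilon>"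
      using setdist_ltE[of "affine_set S" psd \<epsilon>] ne sd by auto
    have "- \<epsilon> * (v \<bullet> v) \<le> v \<bullet> (X *v v)" for v
    proof -
      have "v \<bullet> (X *v v) = v \<bullet> (Y *v v) + v \<bullet> ((X - Y) *v v)" by (simp flip: form_add)
      moreover have "0 \<le> v \<bullet> (Y *v v)" using Y by (simp add: psd_def)
      moreover have "norm (X - Y) * (v \<bullet> v) \<le> \<epsilon> * (v \<bullet> v)"
        using d by (intro mult_right_mono) (auto simp: dist_norm)
      ultimately show ?thesis using abs_form_le[of v "X - Y"] by linarith
    qed
    then show "\<exists>X\<in>sym_mats. sat 1 S X \<and> (\<forall>v\<in>UNIV. - \<epsilon> * (v \<bullet> v) \<le> v \<bullet> (X *v v))"
      using X by (auto simp: affine_set_def sat_1)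
  qed
  moreover have "affine_set S \<noteq> {} \<and> setdist (affine_set S) psd = 0" if near: "nearly_psd UNIV S"
  proof
    have ex: "\<exists>X\<in>affine_set S. X + \<epsilon> *\<^sub>R mat 1 \<in> psd" if "\<epsilon> > 0" for \<epsilon>
      using nearly_psd_shift[OF near that] by (auto simp: affine_set_def sat_1)
    from ex[of 1] show "affine_set S \<noteq> {}" by auto
    show "setdist (affine_set S) psd = 0"
    proof (rule antisym[OF field_le_epsilon])
      fix \<epsilon> :: real assume e: "\<epsilon> > 0"
      let ?c = "norm (mat 1 :: real^'n^'n)"
      define d where "d = \<epsilon> / (?c + 1)"
      have c1: "0 < ?c + 1" by (simp add: add_nonneg_pos)
      then have d: "d > 0" using e by (simp add: d_def)
      then obtain X where "X \<in> affine_set S" "X + d *\<^sub>R mat 1 \<in> psd" using ex by blast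
      then have "setdist (affine_set S) psd \<le> dist X (X + d *\<^sub>R mat 1)" by (rule setdist_le_dist)
      also have "\<dots> = d * ?c" using d by (simp add: dist_norm)
      also have "\<dots> \<le> d * (?c + 1)" using d by (intro mult_left_mono) auto
      also have "\<dots> = \<epsilon>" using c1 by (simp add: d_def)
      finally show "setdist (affine_set S) psd \<le> 0 + \<epsilon>" by simp
    qed (rule setdist_pos_le)
  qed
  ultimately show ?thesis using True by (auto simp: weakly_infeasible_def sat_1)
qed (auto simp: weakly_infeasible_def sat_1)

text \<open>Exchanges and combinations preserve the solutions for every \<open>t\<close>; only
  congruences move them, and successive ones compose to a single \<open>T\<close>.\<close>

lemma reformulation_transport:
  "reformulation S S' \<Longrightarrow>
    \<exists>T T'. T ** T' = mat 1 \<and> (\<forall>t X. sat t S' X \<longleftrightarrow> sat t S (T ** X ** transpose T))"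
  unfolding reformulation_def
proof (induction rule: rtranclp_induct)
  case base
  show ?case by (intro exI[of _ "mat 1"]) (simp add: transpose_mat)
next
  case (step S' S'')
  then obtain T T' where T: "T ** T' = mat 1" "\<And>t X. sat t S' X \<longleftrightarrow> sat t S (T ** X ** transpose T)"
    by blast
  from step(2) show ?case
  proof cases
    case (exchange i j)
    then have "sat t S'' X \<longleftrightarrow> sat t S' X" for t X by (simp add: sat_def set_swap)
    then show ?thesis using T by auto
  next
    case (combine i j lam mu)
    have "sat t S'' X \<longleftrightarrow> sat t S' X" for t X
    proof
      assume s: "sat t S'' X"
      have *: "mat_dot (fst (S'' ! k)) X = t * snd (S'' ! k)" if "k < length S'" for k
        using s that combine by (simp add: sat_def all_set_conv_all_nth)
      have "mat_dot (fst (S' ! k)) X = t * snd (S' ! k)" if "k < length S'" for k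
      proof (cases "k = i")
        case True
        \<comment> \<open>Row \<open>j\<close> is untouched by the step, so it can be subtracted
          before \<open>lam\<close> is cancelled.\<close>
        have "mat_dot (fst (S' ! j)) X = t * snd (S' ! j)" using *[of j] combine by simp
        then have "lam * mat_dot (fst (S' ! i)) X = lam * (t * snd (S' ! i))"
          using *[of i] combine by (simp add: mat_dot_add_left mat_dot_scale_left algebra_simps)
        then show ?thesis using combine True by simp
      qed (use *[of k] that combine in simp)
      then show "sat t S' X" by (simp add: sat_def all_set_conv_all_nth)
    next
      assume "sat t S' X"
      then show "sat t S'' X" using combine
        by (auto simp: sat_def all_set_conv_all_nth nth_list_update mat_dot_add_left
            mat_dot_scale_left algebra_simps)
    qed
    then show ?thesis using T by auto
  next
    case (congruence Q)
    then obtain Q' where Q: "Q ** Q' = mat 1" by (auto simp: invertible_def)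
    have "T ** Q ** (Q' ** T') = mat 1"
      using T(1) Q by (metis matrix_mul_assoc matrix_mul_rid)
    moreover have "sat t S'' X \<longleftrightarrow> sat t S (T ** Q ** X ** transpose (T ** Q))" for t X
    proof -
      have "sat t S'' X \<longleftrightarrow> sat t S' (Q ** X ** transpose Q)"
        unfolding congruence by (auto simp: sat_def mat_dot_congruence)
      then show ?thesis by (simp add: T(2) matrix_transpose_mul matrix_mul_assoc)
    qed
    ultimately show ?thesis by blast
  qed
qed

lemma congruence_psd: "Y \<in> psd \<Longrightarrow> B ** Y ** transpose B \<in> psd" for B :: "real^'n^'n"
  using congruence_sym[of Y B] inner_matrix_congruence[of _ "transpose B" Y] by (simp add: psd_def)

lemma reformulation_weakly_infeasible:
  assumes ref: "reformulation S S'" and weak: "weakly_infeasible S'"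
  shows "weakly_infeasible S"
proof -
  obtain T T' where T: "T ** T' = mat 1"
    and sat: "\<And>t X. sat t S' X \<longleftrightarrow> sat t S (T ** X ** transpose T)"
    using reformulation_transport[OF ref] by blast
  have inf: "\<forall>X\<in>psd. \<not> sat 1 S' X" and near: "nearly_psd UNIV S'"
    using weak by (auto simp: weakly_infeasible_iff)
  have "\<not> sat 1 S Y" if "Y \<in> psd" for Y
  proof -
    have "T ** (T' ** Y ** transpose T') ** transpose T = (T ** T') ** Y ** transpose (T ** T')"
      by (simp add: matrix_transpose_mul matrix_mul_assoc)
    then have "T ** (T' ** Y ** transpose T') ** transpose T = Y" by (simp add: T transpose_mat)
    then show ?thesis using inf congruence_psd[OF that, of T'] sat by metis
  qed
  moreover have "nearly_psd UNIV S" unfolding nearly_psd_def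
  proof (intro allI impI)
    fix \<epsilon> :: real assume e: "\<epsilon> > 0"
    \<comment> \<open>The congruence enlarges \<open>v \<bullet> v\<close> by at most
      \<open>K\<^sup>2\<close>, hence the tolerance \<open>\<epsilon> / K\<^sup>2\<close> for
      \<open>S'\<close>.\<close>
    obtain K where K: "0 < K" "\<And>v. norm (transpose T *v v) \<le> norm v * K"
      using bounded_linear.pos_bounded[OF matrix_vector_mul_bounded_linear[of "transpose T"]] by blast
    have "0 < \<epsilon> / K\<^sup>2" using e K by simp
    then obtain X where X: "X \<in> sym_mats" "sat 1 S' X" "\<And>v. - (\<epsilon> / K\<^sup>2) * (v \<bullet> v) \<le> v \<bullet> (X *v v)"
      using near unfolding nearly_psd_def by blast
    have "- \<epsilon> * (v \<bullet> v) \<le> v \<bullet> ((T ** X ** transpose T) *v v)" for v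
    proof -
      let ?w = "transpose T *v v"
      have "?w \<bullet> ?w \<le> (norm v * K)\<^sup>2"
        using power_mono[OF K(2), of v 2] by (simp add: power2_norm_eq_inner)
      then have "?w \<bullet> ?w \<le> K\<^sup>2 * (v \<bullet> v)" by (simp add: power_mult_distrib power2_norm_eq_inner mult.commute)
      then have "(\<epsilon> / K\<^sup>2) * (?w \<bullet> ?w) \<le> (\<epsilon> / K\<^sup>2) * (K\<^sup>2 * (v \<bullet> v))"
        using e by (intro mult_left_mono) auto
      then have "- \<epsilon> * (v \<bullet> v) \<le> - (\<epsilon> / K\<^sup>2) * (?w \<bullet> ?w)" using K(1) by simp
      also have "\<dots> \<le> ?w \<bullet> (X *v ?w)" by (rule X(3))
      also have "\<dots> = v \<bullet> ((T ** X ** transpose T) *v v)"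
        using inner_matrix_congruence[of v "transpose T" X] by simp
      finally show ?thesis .
    qed
    then show "\<exists>X\<in>sym_mats. sat 1 S X \<and> (\<forall>v\<in>UNIV. - \<epsilon> * (v \<bullet> v) \<le> v \<bullet> (X *v v))"
      using X(2) congruence_sym[OF X(1), of T] sat by blast
  qed
  ultimately show ?thesis by (simp add: weakly_infeasible_iff)
qed

section \<open>The characterisation\<close>

theorem theorem1:
  fixes S :: "'n::finite sdp"
  assumes "set (map fst S) \<subseteq> sym_mats"
  shows "weakly_infeasible S \<longleftrightarrow>
    (\<exists>S'. reformulation S S' \<and>
      (\<exists>k. 1 \<le> k \<and> k + 1 \<le> length S' \<and>
         sd_echelon (take (k + 1) (map fst S')) \<and>
         (\<forall>i<k. rhs S' ! i = 0) \<and> rhs S' ! k = -1) \<and>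
      (\<exists>l Xs. 1 \<le> l \<and> length Xs = l + 1 \<and> sd_echelon Xs \<and>
         (\<forall>i<l. lhs S' (Xs ! i) = replicate (length S') 0) \<and>
         lhs S' (Xs ! l) = rhs S'))" (is "_ \<longleftrightarrow> ?R")
proof
  assume weak: "weakly_infeasible S"
  have infeasible: "\<forall>X\<in>psd. \<not> sat 1 S X" and near: "nearly_psd UNIV S"
    using weak by (auto simp: weakly_infeasible_iff)
  obtain S1 k where S1: "row_equiv S S1" and k: "k < length S1"
    and ech1: "face_seq UNIV (take (k + 1) (map fst S1))"
    and rhs1: "\<forall>i<k. rhs S1 ! i = 0" "rhs S1 ! k = -1"
    using infeasibility_certificate[OF assms subspace_UNIV] infeasible outer_sums_psd by blast
  have sym1: "set (map fst S1) \<subseteq> sym_mats" by (rule row_equiv_sym[OF S1 assms])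
  obtain Xs0 X where X: "face_seq UNIV (Xs0 @ [X])" "\<forall>Y\<in>set Xs0. Y \<in> sym_mats \<and> sat 0 S Y"
    "X \<in> sym_mats" "sat 1 S X"
    using nearly_psd_sequence[OF subspace_UNIV near] by blast
  \<comment> \<open>The leading zero matrix, with an empty block, ensures \<open>l \<ge> 1\<close>.\<close>
  define Xs where "Xs = 0 # Xs0 @ [X]"
  have echXs: "face_seq UNIV Xs" using X(1) by (simp add: Xs_def face_seq_Cons)
  have symXs: "set Xs \<subseteq> sym_mats" using X by (auto simp: Xs_def sym_mats_0)
  have symA: "set (take (k + 1) (map fst S1)) \<subseteq> sym_mats" using sym1 set_take_subset by fast
  obtain T T' :: "real^'n^'n" where T: "T ** T' = mat 1" "T' ** T = mat 1"
    and echA: "sd_echelon (map (\<lambda>A. transpose T ** A ** T) (take (k + 1) (map fst S1)))"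
    and echX: "sd_echelon (map (\<lambda>X. T' ** X ** transpose T') Xs)"
    by (rule sd_echelon_common_basis[OF ech1 symA echXs symXs])
  define S' where "S' = map (\<lambda>(A, \<beta>). (transpose T ** A ** T, \<beta>)) S1"
  have fstS': "map fst S' = map (\<lambda>A. transpose T ** A ** T) (map fst S1)"
    and rhsS': "rhs S' = rhs S1"
    by (auto simp: S'_def rhs_def)
  have ech: "sd_echelon (take (k + 1) (map fst S'))"
    using echA by (simp only: fstS' take_map)
  have sat': "sat t S' (T' ** Y ** transpose T')" if "sat t S Y" for t Y
  proof -
    have "T ** (T' ** Y ** transpose T') ** transpose T = (T ** T') ** Y ** transpose (T ** T')"
      by (simp add: matrix_transpose_mul matrix_mul_assoc)
    then have "sat t S' (T' ** Y ** transpose T') \<longleftrightarrow> sat t S1 Y"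
      by (auto simp: sat_def S'_def mat_dot_congruence T(1) transpose_mat)
    then show ?thesis using that row_equiv_sat[OF S1] by simp
  qed
  define Ys where "Ys = map (\<lambda>X. T' ** X ** transpose T') Xs"
  define l where "l = length Xs0 + 1"
  have lenXs: "length Xs = l + 1" and lastXs: "Xs ! l = X" by (simp_all add: Xs_def l_def nth_append)
  have Ys0: "sat 0 S' (Ys ! i)" if "i < l" for i
  proof -
    have "sat 0 S 0" by (simp add: sat_def mat_dot_sum)
    then have "sat 0 S (Xs ! i)" using that X(2)
      by (cases i) (auto simp: Xs_def l_def nth_append)
    then show ?thesis using sat'[of 0 "Xs ! i"] that by (simp add: Ys_def lenXs)
  qed
  have Ys1: "sat 1 S' (Ys ! l)"
    using sat'[OF X(4)] by (simp add: Ys_def lenXs lastXs)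
  have lenYs: "length Ys = l + 1" by (simp add: Ys_def lenXs)
  have "1 \<le> k"
  proof (rule ccontr)
    assume "\<not> 1 \<le> k"
    then have k0: "k = 0" by simp
    \<comment> \<open>With \<open>k = 0\<close> the first matrix pairs nonnegatively with all of
      \<open>psd\<close>, yet to -1 with every solution. Shifting a solution into \<open>psd\<close>
      by a multiple of the identity so small that the pairing grows by less than 1 gives the
      contradiction.\<close>
    have near': "nearly_psd UNIV S'"
      by (rule sd_echelon_nearly_psd[OF lenYs _ _ Ys1]) (use echX Ys0 in \<open>auto simp: Ys_def\<close>)
    define A where "A = fst (S' ! 0)"
    have len': "0 < length S'" using k by (cases S1) (simp_all add: S'_def)
    have "S' ! 0 \<in> set S'" using len' by simp
    moreover have "snd (S' ! 0) = - 1" using rhs1 k0 len' rhsS' by (metis nth_map rhs_def)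
    ultimately have A1: "mat_dot A X = - 1" if "sat 1 S' X" for X
      using that by (auto simp: sat_def A_def)
    define \<tau> where "\<tau> = mat_dot A (mat 1)"
    define \<epsilon> where "\<epsilon> = 1 / (\<bar>\<tau>\<bar> + 1)"
    have \<epsilon>: "0 < \<epsilon>" "\<epsilon> * \<tau> < 1" by (auto simp: \<epsilon>_def divide_less_eq)
    obtain Y where Y: "sat 1 S' Y" "Y + \<epsilon> *\<^sub>R mat 1 \<in> psd"
      using nearly_psd_shift[OF near' \<epsilon>(1)] by blast
    then have "0 \<le> mat_dot A (Y + \<epsilon> *\<^sub>R mat 1)"
      using sd_echelon_psd_nonneg[OF ech, of _ 0] k0 len' by (simp add: A_def)
    then show False using A1[OF Y(1)] \<epsilon>(2)
      by (simp add: mat_dot_add_right mat_dot_scale_right \<tau>_def)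
  qed
  \<comment> \<open>The bound on \<open>k\<close> also provides the second row that scaling
    requires.\<close>
  moreover have "reformulation S S'"
  proof (rule reformulation_trans)
    show "reformulation S S1"
      using row_equiv_reformulation[OF S1, of "[]"] row_equiv_length[OF S1] k \<open>1 \<le> k\<close> by simp
    have "invertible T" using T by (auto simp: invertible_def)
    then show "reformulation S1 S'"
      unfolding S'_def reformulation_def by (blast intro: reform_step.congruence)
  qed
  ultimately show ?R
    using k ech rhs1 rhsS' lenYs Ys0 Ys1 echX
    by (intro exI[of _ S'] conjI exI[of _ k] exI[of _ l] exI[of _ Ys])
       (auto simp: sat_0 sat_1 Ys_def S'_def l_def)
next
  assume ?R
  then obtain S' k l Xs where ref: "reformulation S S'"
    and k: "1 \<le> k" "k + 1 \<le> length S'" and ech: "sd_echelon (take (k + 1) (map fst S'))"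
    and rhs: "\<forall>i<k. rhs S' ! i = 0" "rhs S' ! k = -1"
    and Xs: "length Xs = l + 1" "sd_echelon Xs" "\<forall>i<l. sat 0 S' (Xs ! i)" "sat 1 S' (Xs ! l)"
    unfolding sat_0 sat_1 by blast
  have "\<not> sat 1 S' X" if X: "X \<in> psd" for X
  proof
    assume "sat 1 S' X"
    then have *: "mat_dot (take (k + 1) (map fst S') ! i) X = rhs S' ! i" if "i \<le> k" for i
      using that k by (simp add: sat_def rhs_def)
    have "0 \<le> mat_dot (take (k + 1) (map fst S') ! k) X"
      by (rule sd_echelon_psd_nonneg[OF ech X]) (use k rhs * in auto)
    then show False using *[of k] rhs by simp
  qed
  moreover have "nearly_psd UNIV S'" by (rule sd_echelon_nearly_psd[OF Xs])
  ultimately have "weakly_infeasible S'" by (simp add: weakly_infeasible_iff)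
  then show "weakly_infeasible S" by (rule reformulation_weakly_infeasible[OF ref])
qed

end
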